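(* Let $m_k,\boldsymbol{u}_k,b_{k,i}$ ($k=1,2$, $i=1,\dots,n_k$) and $\xi_j$ ($j=1,\dots,m$) be smooth fields satisfying, for $k=1,2$ and $i=1,\dots,n_k$, the constraints $$\partial_t m_k+\nabla\cdot(m_k\boldsymbol{u}_k)=0,\qquad \mathrm{D}^k_t b_{k,i}=0,$$ and let $$\mathscr{L}=\mathscr{L}_1\big(m_1,\boldsymbol{u}_1,b_{1,i},b_{2,i},\xi_j,\nabla\xi_j,\mathrm{D}_t^1\xi_j\big)+\mathscr{L}_2\big(m_2,\boldsymbol{u}_2,b_{2,i},b_{1,i},\xi_j,\nabla\xi_j,\mathrm{D}_t^2\xi_j\big)$$ with $\mathscr{L}_1,\mathscr{L}_2$ smooth functions of their arguments. Suppose that the action $\mathscr{A}=\int_t\int_{\Omega_t}\mathscr{L}\,\mathrm{d}\boldsymbol{x}\,\mathrm{d}t$ is stationary, i.e. its first variation satisfies $\delta\mathscr{A}=0$ for all smooth compactly supported virtual displacements $\delta\boldsymbol{\Phi}_1,\delta\boldsymbol{\Phi}_2$ and all smooth compactly supported $\delta\xi_j$ ($j=1,\dots,m$), where the variations of all the fields are given by $$\delta\boldsymbol{u}_k=\mathrm{D}_t^k(\delta\boldsymbol{\Phi}_k)-(\nabla\boldsymbol{u}_k)^\top\delta\boldsymbol{\Phi}_k,\quad \delta m_k=-\nabla\cdot(m_k\delta\boldsymbol{\Phi}_k),\quad \delta b_{k,i}=-(\delta\boldsymbol{\Phi}_k)^\top\nabla b_{k,i},$$ $$\delta(\nabla\xi_j)=\nabla(\delta\xi_j),\qquad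 \delta(\mathrm{D}_t^k\xi_j)=\mathrm{D}_t^k(\delta\xi_j)+(\nabla\xi_j)^\top\delta\boldsymbol{u}_k .$$ Define, for $k=1,2$ and $j=1,\dots,m$, $$\boldsymbol{K}_k=\Big(\frac{\partial\mathscr{L}_k}{\partial\boldsymbol{u}_k}\Big)^\top,\quad \mathscr{M}_{k,j}=\frac{\partial\mathscr{L}_k}{\partial(\mathrm{D}_t^k\xi_j)},\quad \boldsymbol{D}_{k,j}=\Big(\frac{\partial\mathscr{L}_k}{\partial(\nabla\xi_j)}\Big)^\top,$$ $$\boldsymbol{\Pi}_k=\Big(\mathscr{L}_k-m_k\frac{\partial\mathscr{L}_k}{\partial m_k}\Big)\mathbf{I}_d-\sum_{j=1}^m\nabla\xi_j\otimes\boldsymbol{D}_{k,j}.$$ Then the following evolution equations hold: $$\partial_t\boldsymbol{K}_1+\nabla\cdot(\boldsymbol{K}_1\otimes\boldsymbol{u}_1+\boldsymbol{\Pi}_1)=-\sum_{j=1}^m\Big[\partial_t\mathscr{M}_{1,j}+\nabla\cdot(\mathscr{M}_{1,j}\boldsymbol{u}_1)+\nabla\cdot\boldsymbol{D}_{1,j}-\frac{\partial\mathscr{L}_1}{\partial\xi_j}\Big]\nabla\xi_j+\sum_{i=1}^{n_2}\frac{\partial\mathscr{L}_1}{\partial b_{2,i}}\nabla b_{2,i}-\sum_{i=1}^{n_1}\frac{\partial\mathscr{L}_2}{\partial b_{1,i}}\nabla b_{1,i},$$ $$\partial_t\boldsymbol{K}_2+\nabla\cdot(\boldsymbol{K}_2\otimes\boldsymbol{u}_2+\boldsymbol{\Pi}_2)=-\sum_{j=1}^m\Big[\partial_t\mathscr{M}_{2,j}+\nabla\cdot(\mathscr{M}_{2,j}\boldsymbol{u}_2)+\nabla\cdot\boldsymbol{D}_{2,j}-\frac{\partial\mathscr{L}_2}{\partial\xi_j}\Big]\nabla\xi_j-\sum_{i=1}^{n_2}\frac{\partial\mathscr{L}_1}{\partial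 b_{2,i}}\nabla b_{2,i}+\sum_{i=1}^{n_1}\frac{\partial\mathscr{L}_2}{\partial b_{1,i}}\nabla b_{1,i},$$ and, for $j=1,\dots,m$, $$\partial_t(\mathscr{M}_{1,j}+\mathscr{M}_{2,j})+\nabla\cdot\big(\mathscr{M}_{1,j}\boldsymbol{u}_1+\mathscr{M}_{2,j}\boldsymbol{u}_2+\boldsymbol{D}_{1,j}+\boldsymbol{D}_{2,j}\big)-\frac{\partial\mathscr{L}_1}{\partial\xi_j}-\frac{\partial\mathscr{L}_2}{\partial\xi_j}=0.$$
   Context: The fields are defined on a space-time domain $\{(t,\boldsymbol{x}):t\in(t_0,t_1),\ \boldsymbol{x}\in\Omega_t\subset\mathbb{R}^d\}$. The $m_k$, $b_{k,i}$ and $\xi_j$ are scalar fields, $\boldsymbol{u}_k$ is an $\mathbb{R}^d$-valued velocity field, and $\delta\boldsymbol{\Phi}_k$ is an $\mathbb{R}^d$-valued field. Notation $b_{k,i}$ (resp. $\xi_j$) as an argument of $\mathscr{L}_1,\mathscr{L}_2$ stands for dependence on all $i=1,\dots,n_k$ (resp. all $j=1,\dots,m$). Material derivative: $\mathrm{D}_t^k\bullet=\partial_t\bullet+(\boldsymbol{u}_k\cdot\nabla)\bullet$. Partial derivatives $\partial\mathscr{L}_k/\partial(\cdot)$ are taken with respect to the indicated argument slot of $\mathscr{L}_k$, all other slots (including $\nabla\xi_j$ and $\mathrm{D}_t^k\xi_j$) being held fixed, and evaluated along the fields. The first variation $\delta\mathscr{A}$ is the space-time integral of the first-order variation of $\mathscr{L}$,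 i.e. of the sum over all argument slots of $\mathscr{L}_1$ and $\mathscr{L}_2$ of the partial derivative times the variation of the corresponding argument. The $\delta\xi_j$ and $\delta\boldsymbol{\Phi}_k$ are mutually independent, and compact support is understood in the open space-time domain. Conventions: vectors are columns; the derivative of a scalar with respect to a vector is a row vector, and the gradient of a scalar field is a column vector; the gradient $\nabla\boldsymbol{w}$ of a vector field is the transpose of its Jacobian matrix; the divergence of a matrix field is the column vector obtained by taking the divergence of each row; $\boldsymbol{a}\otimes\boldsymbol{b}=\boldsymbol{a}\boldsymbol{b}^\top$; $\mathbf{I}_d$ is the identity matrix. *)

theory Defs
  imports "HOL-Analysis.Analysis"
begin

primrec Ck_on :: "nat \<Rightarrow> 'a::real_normed_vector set \<Rightarrow> ('a \<Rightarrow> 'b::real_normed_vector) \<Rightarrow> bool" where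
  "Ck_on 0 S f \<longleftrightarrow> continuous_on S f"
| "Ck_on (Suc k) S f \<longleftrightarrow>
     (\<forall>x\<in>S. f differentiable (at x)) \<and> (\<forall>v. Ck_on k S (\<lambda>x. frechet_derivative f (at x) v))"

text \<open>Meant for open \<open>S\<close>; only the values of \<open>f\<close> on \<open>S\<close> matter then.\<close>

definition smooth_on :: "'a::real_normed_vector set \<Rightarrow> ('a \<Rightarrow> 'b::real_normed_vector) \<Rightarrow> bool" where
  "smooth_on S f \<longleftrightarrow> (\<forall>k. Ck_on k S f)"

definition test_field :: "'a::real_normed_vector set \<Rightarrow> ('a \<Rightarrow> 'b::real_normed_vector) \<Rightarrow> bool" where
  "test_field S f \<longleftrightarrow>
     smooth_on S f \<and> compact (closure {x\<in>S. f x \<noteq> 0}) \<and> closure {x\<in>S. f x \<noteq> 0} \<subseteq> S"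

text \<open>A point of space-time is a pair \<open>(t, x)\<close>; \<open>partial_x\<close>, \<open>grad_x\<close>, \<open>Grad_x\<close>, \<open>div_x\<close> and
  \<open>Div_x\<close> differentiate in \<open>x\<close> only.\<close>

type_synonym 'd spacetime = "real \<times> (real^'d)"

definition pderiv_vec :: "'n::finite \<Rightarrow> (real^'n \<Rightarrow> 'a::real_normed_vector) \<Rightarrow> real^'n \<Rightarrow> 'a" where
  "pderiv_vec i f x = frechet_derivative f (at x) (axis i 1)"

definition gradient :: "(real^'n::finite \<Rightarrow> real) \<Rightarrow> real^'n \<Rightarrow> real^'n" where
  "gradient f x = (\<chi> i. pderiv_vec i f x)"

definition partial_t :: "('d::finite spacetime \<Rightarrow> 'a::real_normed_vector) \<Rightarrow> 'd spacetime \<Rightarrow> 'a" where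
  "partial_t f z = vector_derivative (\<lambda>s. f (s, snd z)) (at (fst z))"

definition partial_x :: "'d::finite \<Rightarrow> ('d spacetime \<Rightarrow> 'a::real_normed_vector) \<Rightarrow> 'd spacetime \<Rightarrow> 'a" where
  "partial_x i f z = pderiv_vec i (\<lambda>y. f (fst z, y)) (snd z)"

definition grad_x :: "('d::finite spacetime \<Rightarrow> real) \<Rightarrow> 'd spacetime \<Rightarrow> real^'d" where
  "grad_x f z = gradient (\<lambda>y. f (fst z, y)) (snd z)"

definition Grad_x :: "('d::finite spacetime \<Rightarrow> real^'d) \<Rightarrow> 'd spacetime \<Rightarrow> real^'d^'d" where
  "Grad_x w z = transpose (jacobian (\<lambda>y. w (fst z, y)) (at (snd z)))"

definition div_x :: "('d::finite spacetime \<Rightarrow> real^'d) \<Rightarrow> 'd spacetime \<Rightarrow> real" where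
  "div_x w z = (\<Sum>i\<in>UNIV. partial_x i (\<lambda>y. w y $ i) z)"

definition Div_x :: "('d::finite spacetime \<Rightarrow> real^'d^'d) \<Rightarrow> 'd spacetime \<Rightarrow> real^'d" where
  "Div_x A z = (\<chi> i. div_x (\<lambda>y. A y $ i) z)"

definition material ::
  "('d::finite spacetime \<Rightarrow> real^'d) \<Rightarrow> ('d spacetime \<Rightarrow> 'a::real_normed_vector) \<Rightarrow> 'd spacetime \<Rightarrow> 'a" where
  "material u f z = partial_t f z + (\<Sum>i\<in>UNIV. (u z $ i) *\<^sub>R partial_x i f z)"

definition outer :: "real^'d \<Rightarrow> real^'d \<Rightarrow> real^'d^'d" (infixl "\<otimes>" 70) where
  "a \<otimes> b = (\<chi> i j. a $ i * b $ j)"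

text \<open>Both Lagrangians are read in the slot order (mass, velocity, own \<open>b\<close>'s, the other phase's
  \<open>b\<close>'s, \<open>\<xi>\<close>'s, gradients of the \<open>\<xi>\<close>'s, material derivatives of the \<open>\<xi>\<close>'s).\<close>

type_synonym ('d, 'n, 'p, 'm) slots =
  "real \<times> (real^'d) \<times> (real^'n) \<times> (real^'p) \<times> (real^'m) \<times> (real^'d^'m) \<times> (real^'m)"

text \<open>Derivatives with respect to the vector slots (\<open>dL_vel\<close>, \<open>dL_grad\<close>) are returned as columns,
  i.e. already transposed.\<close>

definition dL_mass :: "(('d::finite, 'n::finite, 'p::finite, 'm::finite) slots \<Rightarrow> real) \<Rightarrow> ('d, 'n, 'p, 'm) slots \<Rightarrow> real" where
  "dL_mass L = (\<lambda>(m, u, b, c, x, g, w). deriv (\<lambda>s. L (s, u, b, c, x, g, w)) m)"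

definition dL_vel :: "(('d::finite, 'n::finite, 'p::finite, 'm::finite) slots \<Rightarrow> real) \<Rightarrow> ('d, 'n, 'p, 'm) slots \<Rightarrow> real^'d" where
  "dL_vel L = (\<lambda>(m, u, b, c, x, g, w). gradient (\<lambda>v. L (m, v, b, c, x, g, w)) u)"

definition dL_own :: "'n \<Rightarrow> (('d::finite, 'n::finite, 'p::finite, 'm::finite) slots \<Rightarrow> real) \<Rightarrow> ('d, 'n, 'p, 'm) slots \<Rightarrow> real" where
  "dL_own i L = (\<lambda>(m, u, b, c, x, g, w). pderiv_vec i (\<lambda>v. L (m, u, v, c, x, g, w)) b)"

definition dL_other :: "'p \<Rightarrow> (('d::finite, 'n::finite, 'p::finite, 'm::finite) slots \<Rightarrow> real) \<Rightarrow> ('d, 'n, 'p, 'm) slots \<Rightarrow> real" where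
  "dL_other i L = (\<lambda>(m, u, b, c, x, g, w). pderiv_vec i (\<lambda>v. L (m, u, b, v, x, g, w)) c)"

definition dL_xi :: "'m \<Rightarrow> (('d::finite, 'n::finite, 'p::finite, 'm::finite) slots \<Rightarrow> real) \<Rightarrow> ('d, 'n, 'p, 'm) slots \<Rightarrow> real" where
  "dL_xi j L = (\<lambda>(m, u, b, c, x, g, w). pderiv_vec j (\<lambda>v. L (m, u, b, c, v, g, w)) x)"

definition dL_grad :: "'m \<Rightarrow> (('d::finite, 'n::finite, 'p::finite, 'm::finite) slots \<Rightarrow> real) \<Rightarrow> ('d, 'n, 'p, 'm) slots \<Rightarrow> real^'d" where
  "dL_grad j L = (\<lambda>(m, u, b, c, x, g, w).
     gradient (\<lambda>v. L (m, u, b, c, x, (\<chi> l. if l = j then v else g $ l), w)) (g $ j))"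

definition dL_mat :: "'m \<Rightarrow> (('d::finite, 'n::finite, 'p::finite, 'm::finite) slots \<Rightarrow> real) \<Rightarrow> ('d, 'n, 'p, 'm) slots \<Rightarrow> real" where
  "dL_mat j L = (\<lambda>(m, u, b, c, x, g, w). pderiv_vec j (\<lambda>v. L (m, u, b, c, x, g, v)) w)"

definition slots_along ::
  "('d::finite spacetime \<Rightarrow> real) \<Rightarrow> ('d spacetime \<Rightarrow> real^'d) \<Rightarrow> ('n::finite \<Rightarrow> 'd spacetime \<Rightarrow> real) \<Rightarrow>
   ('p::finite \<Rightarrow> 'd spacetime \<Rightarrow> real) \<Rightarrow> ('m::finite \<Rightarrow> 'd spacetime \<Rightarrow> real) \<Rightarrow>
   'd spacetime \<Rightarrow> ('d, 'n, 'p, 'm) slots" where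
  "slots_along m u b c \<xi> z =
     (m z, u z, (\<chi> i. b i z), (\<chi> i. c i z), (\<chi> j. \<xi> j z),
      (\<chi> j. grad_x (\<xi> j) z), (\<chi> j. material u (\<xi> j) z))"

definition delta_u :: "('d::finite spacetime \<Rightarrow> real^'d) \<Rightarrow> ('d spacetime \<Rightarrow> real^'d) \<Rightarrow> 'd spacetime \<Rightarrow> real^'d" where
  "delta_u u \<Phi> z = material u \<Phi> z - transpose (Grad_x u z) *v \<Phi> z"

definition delta_m :: "('d::finite spacetime \<Rightarrow> real) \<Rightarrow> ('d spacetime \<Rightarrow> real^'d) \<Rightarrow> 'd spacetime \<Rightarrow> real" where
  "delta_m m \<Phi> z = - div_x (\<lambda>y. m y *\<^sub>R \<Phi> y) z"

definition delta_b :: "('d::finite spacetime \<Rightarrow> real) \<Rightarrow> ('d spacetime \<Rightarrow> real^'d) \<Rightarrow> 'd spacetime \<Rightarrow> real" where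
  "delta_b b \<Phi> z = - (\<Phi> z \<bullet> grad_x b z)"

definition delta_material ::
  "('d::finite spacetime \<Rightarrow> real^'d) \<Rightarrow> ('d spacetime \<Rightarrow> real) \<Rightarrow> ('d spacetime \<Rightarrow> real^'d) \<Rightarrow>
   ('d spacetime \<Rightarrow> real) \<Rightarrow> 'd spacetime \<Rightarrow> real" where
  "delta_material u \<xi> \<Phi> \<delta>\<xi> z = material u \<delta>\<xi> z + grad_x \<xi> z \<bullet> delta_u u \<Phi> z"

text \<open>First-order variation of the Lagrangian of one phase: \<open>\<Phi>\<close> is the virtual displacement of
  that phase, \<open>\<Psi>\<close> the one of the other phase (which transports the fields \<open>c\<close>).\<close>

definition delta_L ::
  "(('d::finite, 'n::finite, 'p::finite, 'm::finite) slots \<Rightarrow> real) \<Rightarrow>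
   ('d spacetime \<Rightarrow> real) \<Rightarrow> ('d spacetime \<Rightarrow> real^'d) \<Rightarrow> ('n \<Rightarrow> 'd spacetime \<Rightarrow> real) \<Rightarrow>
   ('p \<Rightarrow> 'd spacetime \<Rightarrow> real) \<Rightarrow> ('m \<Rightarrow> 'd spacetime \<Rightarrow> real) \<Rightarrow>
   ('d spacetime \<Rightarrow> real^'d) \<Rightarrow> ('d spacetime \<Rightarrow> real^'d) \<Rightarrow> ('m \<Rightarrow> 'd spacetime \<Rightarrow> real) \<Rightarrow>
   'd spacetime \<Rightarrow> real" where
  "delta_L L m u b c \<xi> \<Phi> \<Psi> \<delta>\<xi> z =
     (let a = slots_along m u b c \<xi> z in
        dL_mass L a * delta_m m \<Phi> z
      + dL_vel L a \<bullet> delta_u u \<Phi> z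
      + (\<Sum>i\<in>UNIV. dL_own i L a * delta_b (b i) \<Phi> z)
      + (\<Sum>i\<in>UNIV. dL_other i L a * delta_b (c i) \<Psi> z)
      + (\<Sum>j\<in>UNIV. dL_xi j L a * \<delta>\<xi> j z)
      + (\<Sum>j\<in>UNIV. dL_grad j L a \<bullet> grad_x (\<delta>\<xi> j) z)
      + (\<Sum>j\<in>UNIV. dL_mat j L a * delta_material u (\<xi> j) \<Phi> (\<delta>\<xi> j) z))"

definition first_variation ::
  "'d spacetime set \<Rightarrow>
   (('d::finite, 'n::finite, 'p::finite, 'm::finite) slots \<Rightarrow> real) \<Rightarrow> (('d, 'p, 'n, 'm) slots \<Rightarrow> real) \<Rightarrow>
   ('d spacetime \<Rightarrow> real) \<Rightarrow> ('d spacetime \<Rightarrow> real) \<Rightarrow>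
   ('d spacetime \<Rightarrow> real^'d) \<Rightarrow> ('d spacetime \<Rightarrow> real^'d) \<Rightarrow>
   ('n \<Rightarrow> 'd spacetime \<Rightarrow> real) \<Rightarrow> ('p \<Rightarrow> 'd spacetime \<Rightarrow> real) \<Rightarrow> ('m \<Rightarrow> 'd spacetime \<Rightarrow> real) \<Rightarrow>
   ('d spacetime \<Rightarrow> real^'d) \<Rightarrow> ('d spacetime \<Rightarrow> real^'d) \<Rightarrow> ('m \<Rightarrow> 'd spacetime \<Rightarrow> real) \<Rightarrow> real" where
  "first_variation D L1 L2 m1 m2 u1 u2 b1 b2 \<xi> \<Phi>1 \<Phi>2 \<delta>\<xi> =
     (LINT z:D|lborel. delta_L L1 m1 u1 b1 b2 \<xi> \<Phi>1 \<Phi>2 \<delta>\<xi> z + delta_L L2 m2 u2 b2 b1 \<xi> \<Phi>2 \<Phi>1 \<delta>\<xi> z)"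

end

theory Submission
  imports Defs
begin

text \<open>Testing stationarity with \<open>\<delta>\<xi> j = \<phi>\<close>, respectively \<open>\<Phi> = \<phi> e\<^sub>i\<close>, and integrating by parts
  (fundamental lemma of the calculus of variations with smooth bump functions) gives the
  \<open>\<xi>\<close>-equations and, with \<open>P = K + (\<Sum>j. M j \<nabla>\<xi> j)\<close>, the weak momentum law
  \<open>\<partial>\<^sub>t P + Div (P \<otimes> u) + (\<nabla>u) P = m \<nabla>(\<partial>L/\<partial>m) - (\<Sum>l. (\<partial>L/\<partial>b l + \<partial>L'/\<partial>b l) \<nabla>(b l))\<close>,
  where \<open>L'\<close> is the Lagrangian of the other phase. Expanding \<open>\<nabla>L\<close> by the chain rule and
  using \<open>D\<^sub>t (\<nabla>\<xi>) = \<nabla>(D\<^sub>t \<xi>) - (\<nabla>u) \<nabla>\<xi>\<close> (symmetry of second derivatives) turns this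
  into the claimed form with the tensor \<open>\<Pi>\<close>.\<close>

section \<open>Smooth maps\<close>

text \<open>The vector \<open>P\<close> takes the place of \<open>K\<close> because the variation of
  each \<open>D_t \<xi> j\<close> contains the inner product of \<open>\<nabla>\<xi> j\<close> with
  \<open>\<delta>u\<close>; \<open>P\<close> is the full coefficient of \<open>\<delta>u\<close>. A
  displacement of one phase reaches the other Lagrangian only through the fields \<open>b l\<close>
  that it transports. One lemma, with a free coefficient \<open>q l\<close> for that coupling,
  therefore serves both phases. Derivatives in a phase's own \<open>b\<close> slots leave the final
  form, since they enter the weak law with a minus sign and \<open>\<nabla>L\<close> with a plus
  sign. The term \<open>m \<nabla>(\<partial>L/\<partial>m)\<close> joins the mass term of
  \<open>\<nabla>L\<close> to give the gradient of \<open>m \<partial>L/\<partial>m\<close>, whence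
  the scalar part of \<open>\<Pi>\<close>. Of the geometry of the domain only openness is used, so
  integration by parts rests neither on a divergence theorem nor on iterated integrals: test fields
  are extended by zero to the whole space, where Lebesgue measure is translation invariant. Partial
  derivatives, defined on slices, are turned into Frechet derivatives in fixed directions of
  space-time.\<close>

lemma Ck_on_mono_order: "Ck_on (Suc k) S f \<Longrightarrow> Ck_on k S f"
proof (induction k arbitrary: f)
  case 0
  then show ?case
    by (simp add: continuous_at_imp_continuous_on differentiable_imp_continuous_within)
next
  case (Suc k)
  then show ?case by (metis Ck_on.simps(2))
qed

lemma Ck_on_subset: "Ck_on k S f \<Longrightarrow> T \<subseteq> S \<Longrightarrow> Ck_on k T f"
  by (induction k arbitrary: f) (auto intro: continuous_on_subset)

text \<open>\<open>frechet_derivative\<close> is a choice among all derivatives. Both functions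
  satisfy the same \<open>has_derivative\<close> predicate at \<open>x\<close>, so the choices
  coincide even if no derivative exists.\<close>

lemma frechet_derivative_cong_open:
  assumes "open S" "x \<in> S" "\<And>y. y \<in> S \<Longrightarrow> f y = g y"
  shows "frechet_derivative f (at x) = frechet_derivative g (at x)"
proof -
  have "(f has_derivative F) (at x) \<longleftrightarrow> (g has_derivative F) (at x)" for F
    using assms has_derivative_transform_within_open[of f F x UNIV S g]
      has_derivative_transform_within_open[of g F x UNIV S f] by auto
  then show ?thesis by (simp add: frechet_derivative_def)
qed

lemma Ck_on_cong:
  assumes "open S" "\<And>x. x \<in> S \<Longrightarrow> f x = g x" "Ck_on k S f"
  shows "Ck_on k S g"
  using assms(2,3)
proof (induction k arbitrary: f g)
  case 0
  then show ?case using continuous_on_cong[of S S f g] by simp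
next
  case (Suc k)
  have "g differentiable (at x)" if "x \<in> S" for x
    using Suc.prems that assms(1) has_derivative_transform_within_open[of f _ x UNIV S g]
    by (auto simp: differentiable_def) metis
  moreover have "Ck_on k S (\<lambda>x. frechet_derivative g (at x) v)" for v
    by (rule Suc.IH[of "\<lambda>x. frechet_derivative f (at x) v"])
      (use Suc.prems frechet_derivative_cong_open[OF assms(1), of _ f g] in auto)
  ultimately show ?case by simp
qed

text \<open>Lets the inductions below exhibit a derivative \<open>f'\<close> by a differentiation
  rule instead of reasoning about the chosen \<open>frechet_derivative\<close>; uniqueness of
  derivatives identifies the two on \<open>S\<close>.\<close>

lemma Ck_on_SucI:
  assumes "open S" "\<And>x. x \<in> S \<Longrightarrow> (f has_derivative f' x) (at x)"
    and "\<And>v. Ck_on k S (\<lambda>x. f' x v)"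
  shows "Ck_on (Suc k) S f"
proof -
  have "Ck_on k S (\<lambda>x. frechet_derivative f (at x) v)" for v
    by (rule Ck_on_cong[OF assms(1) _ assms(3)[of v]]) (simp add: frechet_derivative_at[OF assms(2), symmetric])
  then show ?thesis using assms(2) by (auto simp: differentiable_def)
qed

lemma Ck_on_SucD:
  assumes "Ck_on (Suc k) S f"
  shows "\<And>x. x \<in> S \<Longrightarrow> (f has_derivative frechet_derivative f (at x)) (at x)"
    and "\<And>v. Ck_on k S (\<lambda>x. frechet_derivative f (at x) v)"
  using assms by (auto simp: frechet_derivative_works)

lemma Ck_on_const [simp]: "Ck_on k S (\<lambda>x. c)"
  by (induction k arbitrary: c) auto

lemma Ck_on_bounded_linear:
  assumes "open S" "bounded_linear T"
  shows "Ck_on k S f \<Longrightarrow> Ck_on k S (\<lambda>x. T (f x))"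
proof (induction k arbitrary: f)
  case 0
  then show ?case using bounded_linear.continuous_on[OF assms(2)] by auto
next
  case (Suc k)
  note f = Ck_on_SucD[OF Suc.prems]
  show ?case
    by (rule Ck_on_SucI[OF assms(1) bounded_linear.has_derivative[OF assms(2) f(1)] Suc.IH[OF f(2)]])
qed

lemma Ck_on_add:
  assumes "open S"
  shows "Ck_on k S f \<Longrightarrow> Ck_on k S g \<Longrightarrow> Ck_on k S (\<lambda>x. f x + g x)"
proof (induction k arbitrary: f g)
  case 0
  then show ?case by (auto intro: continuous_on_add)
next
  case (Suc k)
  note f = Ck_on_SucD[OF Suc.prems(1)] and g = Ck_on_SucD[OF Suc.prems(2)]
  show ?case
    by (rule Ck_on_SucI[OF assms(1) has_derivative_add[OF f(1) g(1)] Suc.IH[OF f(2) g(2)]])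
qed

lemma Ck_on_sum:
  assumes "open S" "finite I" "\<And>i. i \<in> I \<Longrightarrow> Ck_on k S (f i)"
  shows "Ck_on k S (\<lambda>x. \<Sum>i\<in>I. f i x)"
  using assms(2,3) by (induction I) (auto intro: Ck_on_add[OF assms(1)])

lemma Ck_on_bounded_bilinear:
  assumes "open S" "bounded_bilinear B"
  shows "Ck_on k S f \<Longrightarrow> Ck_on k S g \<Longrightarrow> Ck_on k S (\<lambda>x. B (f x) (g x))"
proof (induction k arbitrary: f g)
  case 0
  then show ?case using bounded_bilinear.continuous_on[OF assms(2)] by auto
next
  case (Suc k)
  note f = Ck_on_SucD[OF Suc.prems(1)] and g = Ck_on_SucD[OF Suc.prems(2)]
  show ?case
    by (rule Ck_on_SucI[OF assms(1) bounded_bilinear.FDERIV[OF assms(2) f(1) g(1)]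
          Ck_on_add[OF assms(1) Suc.IH[OF Ck_on_mono_order[OF Suc.prems(1)] g(2)]
            Suc.IH[OF f(2) Ck_on_mono_order[OF Suc.prems(2)]]]])
qed

text \<open>The chain rule evaluates the derivative of \<open>f\<close> in the direction
  \<open>?G x v\<close>, which moves with \<open>x\<close>, whereas \<open>Ck_on\<close> speaks of
  fixed directions only. Expanding that direction in \<open>Basis\<close> leaves a finite sum of
  products with fixed directions; this is why the intermediate space is Euclidean.\<close>

lemma Ck_on_compose:
  fixes g :: "'a::real_normed_vector \<Rightarrow> 'b::euclidean_space" and f :: "'b \<Rightarrow> 'c::real_normed_vector"
  assumes "open S" "open U" "\<And>x. x \<in> S \<Longrightarrow> g x \<in> U"
  shows "Ck_on k U f \<Longrightarrow> Ck_on k S g \<Longrightarrow> Ck_on k S (\<lambda>x. f (g x))"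
proof (induction k arbitrary: f)
  case 0
  then show ?case using assms(3) continuous_on_compose2[of U f S g] by auto
next
  case (Suc k)
  note f = Ck_on_SucD[OF Suc.prems(1)] and g = Ck_on_SucD[OF Suc.prems(2)]
  let ?F = "\<lambda>x. frechet_derivative f (at x)" and ?G = "\<lambda>x. frechet_derivative g (at x)"
  let ?d = "\<lambda>x v. \<Sum>b\<in>Basis. (?G x v \<bullet> b) *\<^sub>R ?F (g x) b"
  have "((\<lambda>x. f (g x)) has_derivative ?d x) (at x)" if "x \<in> S" for x
  proof -
    have "linear (?F (g x))" using f(1)[OF assms(3)[OF that]] has_derivative_linear by blast
    from linear_sum[OF this, of "\<lambda>b. (w \<bullet> b) *\<^sub>R b" Basis for w] linear_scale[OF this]
    have "?F (g x) (\<Sum>b\<in>Basis. (w \<bullet> b) *\<^sub>R b) = (\<Sum>b\<in>Basis. (w \<bullet> b) *\<^sub>R ?F (g x) b)" for w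
      by (simp only:)
    then have rep: "?F (g x) w = (\<Sum>b\<in>Basis. (w \<bullet> b) *\<^sub>R ?F (g x) b)" for w
      unfolding euclidean_representation .
    have "?d x = (\<lambda>v. ?F (g x) (?G x v))" by (rule ext) (rule rep[symmetric])
    then show ?thesis
      using has_derivative_compose[OF g(1)[OF that] f(1)[OF assms(3)[OF that]]] by simp
  qed
  moreover have "Ck_on k S (\<lambda>x. ?d x v)" for v
    by (intro Ck_on_sum assms(1) Ck_on_bounded_bilinear[OF assms(1) bounded_bilinear_scaleR]
        Suc.IH[OF f(2) Ck_on_mono_order[OF Suc.prems(2)]]
        Ck_on_bounded_linear[OF assms(1) bounded_linear_inner_left] g(2)) simp
  ultimately show ?case by (rule Ck_on_SucI[OF assms(1)])
qed

lemma smooth_on_subset: "smooth_on S f \<Longrightarrow> T \<subseteq> S \<Longrightarrow> smooth_on T f"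
  by (auto simp: smooth_on_def intro: Ck_on_subset)

lemma smooth_on_cong: "smooth_on S f \<Longrightarrow> open S \<Longrightarrow> (\<And>x. x \<in> S \<Longrightarrow> f x = g x) \<Longrightarrow> smooth_on S g"
  unfolding smooth_on_def using Ck_on_cong by blast

lemma smooth_on_has_derivative:
  "smooth_on S f \<Longrightarrow> x \<in> S \<Longrightarrow> (f has_derivative frechet_derivative f (at x)) (at x)"
  unfolding smooth_on_def by (metis Ck_on_SucD(1))

lemma smooth_on_differentiable: "smooth_on S f \<Longrightarrow> x \<in> S \<Longrightarrow> f differentiable (at x)"
  unfolding smooth_on_def by (metis Ck_on.simps(2))

lemma smooth_on_frechet_derivative:
  "smooth_on S f \<Longrightarrow> smooth_on S (\<lambda>x. frechet_derivative f (at x) v)"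
  unfolding smooth_on_def by (metis Ck_on_SucD(2))

lemma smooth_on_continuous_on: "smooth_on S f \<Longrightarrow> continuous_on S f"
  unfolding smooth_on_def by (metis Ck_on.simps(1))

lemma smooth_on_const [simp]: "smooth_on S (\<lambda>x. c)"
  by (simp add: smooth_on_def)

lemma smooth_on_bounded_linear:
  "open S \<Longrightarrow> bounded_linear T \<Longrightarrow> smooth_on S f \<Longrightarrow> smooth_on S (\<lambda>x. T (f x))"
  by (simp add: smooth_on_def Ck_on_bounded_linear)

lemma smooth_on_add:
  "open S \<Longrightarrow> smooth_on S f \<Longrightarrow> smooth_on S g \<Longrightarrow> smooth_on S (\<lambda>x. f x + g x)"
  by (simp add: smooth_on_def Ck_on_add)

lemma smooth_on_sum:
  "open S \<Longrightarrow> finite I \<Longrightarrow> (\<And>i. i \<in> I \<Longrightarrow> smooth_on S (f i)) \<Longrightarrow> smooth_on S (\<lambda>x. \<Sum>i\<in>I. f i x)"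
  by (simp add: smooth_on_def Ck_on_sum)

lemma smooth_on_bounded_bilinear:
  "open S \<Longrightarrow> bounded_bilinear B \<Longrightarrow> smooth_on S f \<Longrightarrow> smooth_on S g
    \<Longrightarrow> smooth_on S (\<lambda>x. B (f x) (g x))"
  by (simp add: smooth_on_def Ck_on_bounded_bilinear)

lemma smooth_on_compose:
  fixes g :: "'a::real_normed_vector \<Rightarrow> 'b::euclidean_space"
  shows "open S \<Longrightarrow> open U \<Longrightarrow> (\<And>x. x \<in> S \<Longrightarrow> g x \<in> U) \<Longrightarrow> smooth_on U f \<Longrightarrow> smooth_on S g
    \<Longrightarrow> smooth_on S (\<lambda>x. f (g x))"
  unfolding smooth_on_def using Ck_on_compose by blast

lemma smooth_on_ident: "open S \<Longrightarrow> smooth_on S (\<lambda>x. x)"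
proof -
  assume "open S"
  then have "Ck_on k S (\<lambda>x. x)" for k
    by (cases k) auto
  then show ?thesis by (simp add: smooth_on_def)
qed

lemma smooth_on_mult:
  fixes f g :: "'a::real_normed_vector \<Rightarrow> real"
  shows "open S \<Longrightarrow> smooth_on S f \<Longrightarrow> smooth_on S g \<Longrightarrow> smooth_on S (\<lambda>x. f x * g x)"
  by (rule smooth_on_bounded_bilinear[OF _ bounded_bilinear_mult])

lemma smooth_on_scaleR:
  "open S \<Longrightarrow> smooth_on S f \<Longrightarrow> smooth_on S g \<Longrightarrow> smooth_on S (\<lambda>x. f x *\<^sub>R g x)"
  by (rule smooth_on_bounded_bilinear[OF _ bounded_bilinear_scaleR])

lemma smooth_on_inner:
  "open S \<Longrightarrow> smooth_on S f \<Longrightarrow> smooth_on S g \<Longrightarrow> smooth_on S (\<lambda>x. f x \<bullet> g x)"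
  by (rule smooth_on_bounded_bilinear[OF _ bounded_bilinear_inner])

lemma smooth_on_minus: "open S \<Longrightarrow> smooth_on S f \<Longrightarrow> smooth_on S (\<lambda>x. - f x)"
  by (rule smooth_on_bounded_linear[OF _ bounded_linear_minus[OF bounded_linear_ident]])

lemma smooth_on_diff:
  "open S \<Longrightarrow> smooth_on S f \<Longrightarrow> smooth_on S g \<Longrightarrow> smooth_on S (\<lambda>x. f x - g x)"
  using smooth_on_add[of S f "\<lambda>x. - g x"] smooth_on_minus by auto

lemma smooth_on_vec_nth: "open S \<Longrightarrow> smooth_on S f \<Longrightarrow> smooth_on S (\<lambda>x. f x $ i)"
  by (rule smooth_on_bounded_linear[OF _ bounded_linear_vec_nth])

lemma smooth_on_Pair:
  fixes f :: "'a::real_normed_vector \<Rightarrow> 'b::real_normed_vector" and g :: "'a \<Rightarrow> 'c::real_normed_vector"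
  assumes "open S" "smooth_on S f" "smooth_on S g"
  shows "smooth_on S (\<lambda>x. (f x, g x))"
proof -
  have l: "bounded_linear (\<lambda>a::'b. (a, 0::'c))"
    by (rule bounded_linear_Pair[OF bounded_linear_ident bounded_linear_zero])
  have r: "bounded_linear (\<lambda>b::'c. (0::'b, b))"
    by (rule bounded_linear_Pair[OF bounded_linear_zero bounded_linear_ident])
  have "smooth_on S (\<lambda>x. (f x, 0) + (0, g x))"
    by (rule smooth_on_add[OF assms(1) smooth_on_bounded_linear[OF assms(1) l assms(2)]
          smooth_on_bounded_linear[OF assms(1) r assms(3)]])
  then show ?thesis by simp
qed

text \<open>Writing a vector as the sum of its \<open>axis\<close> parts reduces derivatives and
  smoothness to components. The components may lie in any normed space because the gradient slot is
  a vector of vectors.\<close>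

lemma bounded_linear_axis: "bounded_linear (\<lambda>a::'a::real_normed_vector. axis i a :: 'a^'n::finite)"
proof (rule bounded_linear_intro[where K=1])
  fix a :: 'a
  have "norm (axis i a :: 'a^'n) \<le> (\<Sum>j\<in>UNIV. norm ((axis i a :: 'a^'n) $ j))"
    unfolding norm_vec_def by (rule L2_set_le_sum) simp
  also have "\<dots> = (\<Sum>j\<in>UNIV. if j = i then norm a else 0)"
    by (intro sum.cong) (auto simp: axis_def)
  finally show "norm (axis i a :: 'a^'n) \<le> norm a * 1" by simp
qed (auto simp: axis_def vec_eq_iff)

lemma sum_axis:
  fixes f :: "'n::finite \<Rightarrow> 'a::comm_monoid_add"
  shows "(\<Sum>i\<in>UNIV. axis i (f i)) = (\<chi> i. f i)"
  by (simp add: vec_eq_iff axis_def)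

lemma has_derivative_vec_lambda:
  fixes f :: "'n::finite \<Rightarrow> 'a::real_normed_vector \<Rightarrow> 'b::real_normed_vector"
  assumes "\<And>i. (f i has_derivative f' i) F"
  shows "((\<lambda>x. \<chi> i. f i x) has_derivative (\<lambda>h. \<chi> i. f' i h)) F"
proof -
  have "((\<lambda>x. \<Sum>i\<in>UNIV. axis i (f i x)) has_derivative (\<lambda>h. \<Sum>i\<in>UNIV. axis i (f' i h))) F"
    by (intro has_derivative_sum bounded_linear.has_derivative[OF bounded_linear_axis] assms)
  then show ?thesis by (simp only: sum_axis)
qed

lemma smooth_on_vec_lambda:
  fixes f :: "'n::finite \<Rightarrow> 'a::real_normed_vector \<Rightarrow> 'b::real_normed_vector"
  assumes "open S" "\<And>i. smooth_on S (f i)"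
  shows "smooth_on S (\<lambda>x. \<chi> i. f i x)"
proof -
  have "smooth_on S (\<lambda>x. \<Sum>i\<in>UNIV. axis i (f i x))"
    by (intro smooth_on_sum smooth_on_bounded_linear[OF _ bounded_linear_axis] assms) simp
  then show ?thesis by (simp only: sum_axis)
qed

section \<open>Test fields and the fundamental lemma\<close>

text \<open>The derivatives of \<open>exp (- 1/x)\<close> on the positive reals are combinations of these functions.\<close>

definition flat :: "nat \<Rightarrow> real \<Rightarrow> real" where
  "flat n x = (if x > 0 then exp (- inverse x) * inverse x ^ n else 0)"

text \<open>With \<open>y = inverse x\<close> the limit from the right is the decay of
  \<open>y ^ n / exp y\<close> at infinity; on the left the function is zero.\<close>

lemma flat_tendsto_0: "(flat n \<longlongrightarrow> 0) (at 0)"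
proof -
  have "((\<lambda>x. inverse x ^ n / exp (inverse x)) \<longlongrightarrow> 0) (at_right (0::real))"
    by (rule filterlim_compose[OF tendsto_power_div_exp_0 filterlim_inverse_at_top_right])
  then have "(flat n \<longlongrightarrow> 0) (at_right 0)"
    by (rule Lim_transform_eventually)
      (auto simp: flat_def eventually_at_filter exp_minus divide_inverse mult.commute)
  moreover have "(flat n \<longlongrightarrow> 0) (at_left 0)"
    by (rule tendsto_eventually) (auto simp: flat_def eventually_at_filter)
  ultimately show ?thesis using filterlim_split_at by blast
qed

text \<open>Differentiating the exponential contributes \<open>inverse x ^ 2\<close>, hence the
  index \<open>n + 2\<close>; differentiating the power raises the index by one. The family is thus
  closed under differentiation up to linear combinations, and one induction over all
  \<open>n\<close> at once gives smoothness.\<close>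

lemma flat_has_real_derivative:
  "(flat n has_real_derivative flat (n + 2) x - real n * flat (n + 1) x) (at x)"
proof -
  consider "x > 0" | "x < 0" | "x = 0" by linarith
  then show ?thesis
  proof cases
    case 1
    have "((\<lambda>x. exp (- inverse x) * inverse x ^ n) has_real_derivative
        exp (- inverse x) * inverse x ^ (n + 2) - real n * (exp (- inverse x) * inverse x ^ (n + 1))) (at x)"
    proof (rule DERIV_cong[OF DERIV_mult])
      show "((\<lambda>x. exp (- inverse x)) has_real_derivative exp (- inverse x) * inverse x ^ 2) (at x)"
        using 1 by (auto intro!: derivative_eq_intros simp: power2_eq_square)
      show "((\<lambda>x. inverse x ^ n) has_real_derivative real n * (- (inverse x ^ Suc (Suc 0)) * inverse x ^ (n - Suc 0))) (at x)"
        using 1 by (intro DERIV_power DERIV_inverse) simp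
    qed (cases n, auto simp: algebra_simps power2_eq_square)
    then show ?thesis
      using 1 by (auto simp: flat_def intro: has_field_derivative_transform_within_open[of _ _ _ "{0<..}"])
  next
    case 2
    then show ?thesis
      by (auto simp: flat_def intro: has_field_derivative_transform_within_open[of "\<lambda>_. 0" _ _ "{..<0}"])
  next
    case 3
    \<comment> \<open>At the origin the difference quotient is itself a member of the family, so its
      limit is already known to be zero.\<close>
    have "(flat n h - flat n 0) / (h - 0) = flat (Suc n) h" for h
      by (simp add: flat_def divide_inverse mult.assoc mult.commute)
    then show ?thesis
      using 3 flat_tendsto_0[of "Suc n"] by (simp add: has_field_derivative_iff flat_def[of _ 0])
  qed
qed

lemma smooth_on_flat: "smooth_on UNIV (flat n)"
proof -
  have "Ck_on k UNIV (flat n)" for k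
  proof (induction k arbitrary: n)
    case 0
    show ?case
      by (auto intro!: continuous_at_imp_continuous_on DERIV_isCont flat_has_real_derivative)
  next
    case (Suc k)
    have "(flat n has_derivative (\<lambda>v. v * flat (n + 2) x + (- real n * v) * flat (n + 1) x)) (at x)" for x
      by (rule has_derivative_eq_rhs[OF has_field_derivative_imp_has_derivative[OF flat_has_real_derivative]])
        (auto simp: algebra_simps)
    then show ?case
      by (rule Ck_on_SucI[OF open_UNIV])
        (intro Ck_on_add Ck_on_bounded_linear[OF _ bounded_linear_mult_right] Suc.IH open_UNIV)
  qed
  then show ?thesis by (simp add: smooth_on_def)
qed

text \<open>The inclusion is in the closed support of \<open>f\<close>, not in its nonzero set: a
  derivative of \<open>f\<close> may well be nonzero at a point where \<open>f\<close> vanishes, but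
  not off the support.\<close>

lemma test_field_subset_support:
  assumes "test_field S f" "smooth_on S g" "{x\<in>S. g x \<noteq> 0} \<subseteq> closure {x\<in>S. f x \<noteq> 0}"
  shows "test_field S g"
proof -
  have "closure {x\<in>S. g x \<noteq> 0} \<subseteq> closure {x\<in>S. f x \<noteq> 0}"
    using assms(3) by (simp add: closure_minimal)
  moreover from this have "compact (closure {x\<in>S. g x \<noteq> 0})"
    using assms(1) closed_Int_compact[of "closure {x\<in>S. g x \<noteq> 0}" "closure {x\<in>S. f x \<noteq> 0}"]
    by (simp add: test_field_def inf.absorb1)
  ultimately show ?thesis using assms(1,2) by (auto simp: test_field_def)
qed

lemma test_field_smooth_on: "test_field S f \<Longrightarrow> smooth_on S f"
  by (simp add: test_field_def)

lemma test_field_zero [simp]: "test_field S (\<lambda>x. 0)"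
  by (simp add: test_field_def)

lemma test_field_mult:
  fixes f g :: "'a::real_normed_vector \<Rightarrow> real"
  assumes "open S" "smooth_on S g" "test_field S f"
  shows "test_field S (\<lambda>x. g x * f x)"
  using closure_subset[of "{x \<in> S. f x \<noteq> 0}"]
  by (intro test_field_subset_support[OF assms(3)]
      smooth_on_mult[OF assms(1,2) test_field_smooth_on[OF assms(3)]]) auto

lemma test_field_scaleR_const:
  assumes "open S" "test_field S f"
  shows "test_field S (\<lambda>x. f x *\<^sub>R c)"
  using closure_subset[of "{x \<in> S. f x \<noteq> 0}"]
  by (intro test_field_subset_support[OF assms(2)]
      smooth_on_scaleR[OF assms(1) test_field_smooth_on[OF assms(2)] smooth_on_const]) auto

lemma frechet_derivative_outside_support:
  assumes "open S" "x \<in> S" "x \<notin> closure {x\<in>S. f x \<noteq> 0}"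
  shows "frechet_derivative f (at x) v = 0"
proof -
  have "frechet_derivative f (at x) = frechet_derivative (\<lambda>x. 0) (at x)"
    by (rule frechet_derivative_cong_open[of "S - closure {x\<in>S. f x \<noteq> 0}"])
      (use assms closure_subset[of "{x \<in> S. f x \<noteq> 0}"] in \<open>auto intro: open_Diff\<close>)
  then show ?thesis by simp
qed

lemma test_field_frechet_derivative:
  assumes "open S" "test_field S f"
  shows "test_field S (\<lambda>x. frechet_derivative f (at x) v)"
  by (intro test_field_subset_support[OF assms(2)]
      smooth_on_frechet_derivative[OF test_field_smooth_on[OF assms(2)]])
    (use frechet_derivative_outside_support[OF assms(1)] in auto)

lemma test_field_bounded:
  fixes f :: "'a::real_normed_vector \<Rightarrow> real"
  assumes "test_field S f"
  obtains B where "B \<ge> 0" "\<And>x. x \<in> S \<Longrightarrow> \<bar>f x\<bar> \<le> B"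
proof -
  let ?K = "closure {x\<in>S. f x \<noteq> 0}"
  have "compact (f ` ?K)"
    using assms continuous_on_subset[OF smooth_on_continuous_on[OF test_field_smooth_on[OF assms]]]
    by (intro compact_continuous_image) (auto simp: test_field_def)
  from compact_imp_bounded[OF this]
  obtain B where B: "B > 0" "\<And>y. y \<in> f ` ?K \<Longrightarrow> norm y \<le> B"
    unfolding bounded_pos by blast
  have "\<bar>f x\<bar> \<le> B" if "x \<in> S" for x
  proof (cases "f x = 0")
    case False
    then have "x \<in> ?K" using that closure_subset[of "{x\<in>S. f x \<noteq> 0}"] by auto
    then show ?thesis using B(2)[OF imageI[of x ?K f]] by simp
  qed (use B(1) in simp)
  then show ?thesis using that[of B] B(1) by auto
qed

lemma test_field_set_integrable:
  fixes f :: "'a::euclidean_space \<Rightarrow> real"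
  assumes "test_field S f"
  shows "set_integrable lborel S f"
proof -
  let ?K = "closure {x\<in>S. f x \<noteq> 0}"
  have "continuous_on ?K f" "compact ?K" "?K \<subseteq> S"
    using assms continuous_on_subset[OF smooth_on_continuous_on[OF test_field_smooth_on[OF assms]]]
    by (auto simp: test_field_def)
  then have "integrable lborel (\<lambda>x. indicator ?K x *\<^sub>R f x)"
    by (intro borel_integrable_compact) auto
  moreover have "indicator ?K x *\<^sub>R f x = indicator S x *\<^sub>R f x" for x
    using \<open>?K \<subseteq> S\<close> closure_subset[of "{x \<in> S. f x \<noteq> 0}"] by (auto simp: indicator_def)
  ultimately show ?thesis by (simp only: set_integrable_def)
qed

section \<open>Integrals of derivatives of test fields\<close>

lemma has_real_derivative_along_line:
  fixes f :: "'a::real_normed_vector \<Rightarrow> real"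
  assumes "(f has_derivative f') (at (x + s *\<^sub>R v))"
  shows "((\<lambda>s. f (x + s *\<^sub>R v)) has_real_derivative f' v) (at s)"
proof -
  have "((\<lambda>s. x + s *\<^sub>R v) has_derivative (\<lambda>h. h *\<^sub>R v)) (at s)"
    by (auto intro!: derivative_eq_intros)
  from has_derivative_compose[OF this assms]
  have "((\<lambda>s. f (x + s *\<^sub>R v)) has_derivative (\<lambda>h. f' (h *\<^sub>R v))) (at s)" .
  moreover have "(\<lambda>h. f' (h *\<^sub>R v)) = (*) (f' v)"
    using linear_scale[OF has_derivative_linear[OF assms]] by (simp add: fun_eq_iff)
  ultimately show ?thesis by (simp add: has_field_derivative_def)
qed

text \<open>The difference quotients of a test field in direction \<open>v\<close> have integral zero by translation
  invariance, and they converge dominatedly to its derivative.\<close>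

lemma set_integral_frechet_derivative_test_field:
  fixes f :: "'a::euclidean_space \<Rightarrow> real"
  assumes "open S" "test_field S f"
  shows "(LINT x:S|lborel. frechet_derivative f (at x) v) = 0"
proof -
  let ?K = "closure {x\<in>S. f x \<noteq> 0}"
  define F where "F x = indicator S x *\<^sub>R f x" for x
  define G where "G x = indicator S x *\<^sub>R frechet_derivative f (at x) v" for x
  have K: "compact ?K" "?K \<subseteq> S" using assms(2) by (auto simp: test_field_def)
  have F0: "F x = 0" if "x \<notin> ?K" for x
    using that closure_subset[of "{x \<in> S. f x \<noteq> 0}"] by (auto simp: F_def indicator_def)
  \<comment> \<open>The extension by zero is differentiable everywhere, however irregular the
    boundary of \<open>S\<close>: a point outside \<open>S\<close> lies in the open set
    \<open>- ?K\<close>, on which \<open>F\<close> vanishes.\<close>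
  have der: "(F has_derivative (\<lambda>w. indicator S x *\<^sub>R frechet_derivative f (at x) w)) (at x)" for x
  proof (cases "x \<in> S")
    case True
    have "(F has_derivative frechet_derivative f (at x)) (at x)"
      by (rule has_derivative_transform_within_open[OF
            smooth_on_has_derivative[OF test_field_smooth_on[OF assms(2)] True] assms(1) True])
        (simp add: F_def)
    then show ?thesis using True by simp
  next
    case False
    have "(F has_derivative (\<lambda>w. 0)) (at x)"
      by (rule has_derivative_transform_within_open[of "\<lambda>_. 0" _ _ _ "- ?K"])
        (use False K F0 in auto)
    then show ?thesis using False by simp
  qed
  have line: "((\<lambda>s. F (x + s *\<^sub>R v)) has_real_derivative G (x + s *\<^sub>R v)) (at s)" for x s
    unfolding G_def by (rule has_real_derivative_along_line[OF der])
  have intF: "integrable lborel F"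
    using test_field_set_integrable[OF assms(2)] by (simp add: set_integrable_def F_def[abs_def])
  have intG: "integrable lborel G"
    using test_field_set_integrable[OF test_field_frechet_derivative[OF assms]]
    by (simp add: set_integrable_def G_def[abs_def])
  have shift: "integrable lborel (\<lambda>x. F (x + c))" "integral\<^sup>L lborel (\<lambda>x. F (x + c)) = integral\<^sup>L lborel F" for c
  proof -
    have m: "F \<in> borel_measurable borel" using intF by auto
    show "integrable lborel (\<lambda>x. F (x + c))"
      using integrable_distr_eq[of "(+) c" lborel borel F] m intF
      by (simp add: lborel_distr_plus add.commute)
    show "integral\<^sup>L lborel (\<lambda>x. F (x + c)) = integral\<^sup>L lborel F"
      using integral_distr[of "(+) c" lborel borel F] m
      by (simp add: lborel_distr_plus add.commute)
  qed
  obtain B where B: "B \<ge> 0" "\<And>x. x \<in> S \<Longrightarrow> \<bar>frechet_derivative f (at x) v\<bar> \<le> B"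
    using test_field_bounded[OF test_field_frechet_derivative[OF assms]] by blast
  then have GB: "\<bar>G x\<bar> \<le> B" for x by (auto simp: G_def indicator_def)
  obtain R where R: "\<And>x. x \<in> ?K \<Longrightarrow> norm x \<le> R"
    using compact_imp_bounded[OF K(1)] by (auto simp: bounded_iff)
  \<comment> \<open>Step sizes at most 1 move a point by at most \<open>norm v\<close>, so a single
    ball dominates all difference quotients.\<close>
  define h where "h i = inverse (real (Suc i))" for i
  have h: "0 < h i" "h i \<le> 1" for i by (auto simp: h_def divide_simps)
  define s where "s i x = (F (x + h i *\<^sub>R v) - F x) / h i" for i x
  have s0: "integral\<^sup>L lborel (s i) = 0" for i
    using shift[of "h i *\<^sub>R v"] intF by (simp add: s_def[abs_def])
  have lim: "(\<lambda>i. s i x) \<longlonglongrightarrow> G x" for x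
  proof -
    have "((\<lambda>t. (F (x + t *\<^sub>R v) - F x) / t) \<longlongrightarrow> G x) (at 0)"
      using line[of x 0] by (simp add: has_field_derivative_iff)
    moreover have "filterlim h (at 0) sequentially"
      using LIMSEQ_inverse_real_of_nat h by (auto simp: filterlim_at h_def[abs_def])
    ultimately show ?thesis unfolding s_def by (rule filterlim_compose)
  qed
  \<comment> \<open>Inside the ball the mean value theorem turns the quotient into a value of
    \<open>G\<close>. Outside it, both \<open>x\<close> and the shifted point have norm above
    \<open>R\<close>, and both values of \<open>F\<close> vanish.\<close>
  have bound: "norm (s i x) \<le> indicator (cball 0 (R + norm v)) x *\<^sub>R B" for i x
  proof (cases "norm x \<le> R + norm v")
    case True
    obtain t where "F (x + h i *\<^sub>R v) - F (x + 0 *\<^sub>R v) = (h i - 0) * G (x + t *\<^sub>R v)"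
      using MVT2[OF h(1)[of i], of "\<lambda>s. F (x + s *\<^sub>R v)" "\<lambda>s. G (x + s *\<^sub>R v)"] line by blast
    then have "s i x = G (x + t *\<^sub>R v)" using h(1)[of i] by (simp add: s_def)
    then show ?thesis using GB True by simp
  next
    case False
    have "norm x \<le> norm (x + h i *\<^sub>R v) + norm (h i *\<^sub>R v)"
      by (metis add_diff_cancel_right' norm_triangle_ineq4)
    also have "norm (h i *\<^sub>R v) \<le> norm v" using h[of i] by (simp add: mult_left_le_one_le)
    finally have "norm (x + h i *\<^sub>R v) > R" using False by simp
    then have "F (x + h i *\<^sub>R v) = 0" using R F0 by force
    moreover have "norm x > R" using False norm_ge_zero[of v] by linarith
    then have "F x = 0" using R F0 by force
    ultimately show ?thesis using False by (simp add: s_def)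
  qed
  have "(\<lambda>i. integral\<^sup>L lborel (s i)) \<longlonglongrightarrow> integral\<^sup>L lborel G"
  proof (rule integral_dominated_convergence)
    show "integrable lborel (\<lambda>x. indicator (cball 0 (R + norm v)) x *\<^sub>R B)"
      by (rule borel_integrable_compact) auto
    show "s i \<in> borel_measurable lborel" for i
      unfolding s_def using borel_measurable_integrable[OF shift(1)] borel_measurable_integrable[OF intF]
      by measurable
  qed (use bound lim intG in auto)
  then have "integral\<^sup>L lborel G = 0" by (simp add: s0 LIMSEQ_const_iff)
  then show ?thesis by (simp add: set_lebesgue_integral_def G_def[abs_def])
qed

text \<open>The bump is \<open>flat 0\<close> applied to \<open>r\<^sup>2\<close> minus the squared
  distance from \<open>z0\<close>. The square makes the argument polynomial, hence smooth at the
  centre as well. The closed ball must lie in \<open>S\<close> because the support is a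
  closure.\<close>

lemma bump_test_field:
  fixes z0 :: "'a::euclidean_space"
  assumes "cball z0 r \<subseteq> S" "r > 0"
  shows "\<exists>\<phi> :: 'a \<Rightarrow> real. test_field S \<phi> \<and> (\<forall>z\<in>ball z0 r. \<phi> z > 0) \<and> (\<forall>z. z \<notin> ball z0 r \<longrightarrow> \<phi> z = 0)"
proof -
  let ?\<phi> = "\<lambda>z. flat 0 (r\<^sup>2 - (z - z0) \<bullet> (z - z0))"
  have pos: "r\<^sup>2 - (z - z0) \<bullet> (z - z0) > 0 \<longleftrightarrow> z \<in> ball z0 r" for z
    using assms(2) power_mono[of r "dist z z0" 2] power_strict_mono[of "dist z z0" r 2]
    by (auto simp: dot_square_norm dist_norm[symmetric] dist_commute not_less[symmetric])
  then have posv: "?\<phi> z > 0" if "z \<in> ball z0 r" for z using that by (simp add: flat_def)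
  from pos have zero: "?\<phi> z = 0" if "z \<notin> ball z0 r" for z using that by (simp add: flat_def)
  have smooth: "smooth_on UNIV ?\<phi>"
    by (intro smooth_on_compose[OF open_UNIV open_UNIV _ smooth_on_flat] smooth_on_diff smooth_on_inner
        smooth_on_ident smooth_on_const open_UNIV) simp
  let ?K = "closure {x\<in>S. ?\<phi> x \<noteq> 0}"
  have sub: "?K \<subseteq> cball z0 r"
  proof (rule closure_minimal[OF subsetI closed_cball])
    fix x assume "x \<in> {x\<in>S. ?\<phi> x \<noteq> 0}"
    then have "x \<in> ball z0 r" using zero[of x] by blast
    then show "x \<in> cball z0 r" by simp
  qed
  have "compact (?K \<inter> cball z0 r)" by (rule closed_Int_compact[OF closed_closure compact_cball])
  then have "compact ?K" unfolding inf.absorb1[OF sub] .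
  then have "test_field S ?\<phi>"
    using assms(1) sub smooth_on_subset[OF smooth, of S] unfolding test_field_def by blast
  with posv zero show ?thesis by (intro exI[of _ ?\<phi>]) simp
qed

text \<open>If \<open>E z0\<close> were positive, \<open>E\<close> would be positive on a small
  ball. Against a bump on that ball the integrand is nonnegative with integral zero, hence zero
  almost everywhere, although it is positive on a set of positive measure. The opposite inequality
  follows by passing to \<open>- E\<close>.\<close>

lemma fundamental_lemma_le:
  fixes E :: "'a::euclidean_space \<Rightarrow> real"
  assumes "open S" "smooth_on S E"
    and weak: "\<And>\<phi>. test_field S \<phi> \<Longrightarrow> (LINT z:S|lborel. E z * \<phi> z) = 0"
    and "z0 \<in> S"
  shows "E z0 \<le> 0"
proof (rule ccontr)
  assume "\<not> E z0 \<le> 0"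
  moreover have "open {z\<in>S. E z \<in> {0<..}}"
    using continuous_open_preimage[OF smooth_on_continuous_on[OF assms(2)] assms(1), of "{0<..}"]
    by (simp add: vimage_def Int_def)
  ultimately obtain r where r: "r > 0" "cball z0 r \<subseteq> {z\<in>S. E z \<in> {0<..}}"
    using assms(4) unfolding open_contains_cball by force
  then have "cball z0 r \<subseteq> S" by auto
  from bump_test_field[OF this r(1)] obtain \<phi> :: "'a \<Rightarrow> real"
    where \<phi>: "test_field S \<phi> \<and> (\<forall>z\<in>ball z0 r. \<phi> z > 0) \<and> (\<forall>z. z \<notin> ball z0 r \<longrightarrow> \<phi> z = 0)" ..
  then have test: "test_field S \<phi>" by simp
  let ?g = "\<lambda>z. indicator S z *\<^sub>R (E z * \<phi> z)"
  have pos: "?g z > 0" if "z \<in> ball z0 r" for z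
  proof -
    have "z \<in> cball z0 r" using that by auto
    then have "z \<in> S" "E z > 0" using r(2) by auto
    then show ?thesis using \<phi> that by simp
  qed
  then have nonneg: "?g z \<ge> 0" for z
    using \<phi> by (cases "z \<in> ball z0 r") (auto intro: less_imp_le)
  have "integrable lborel ?g"
    using test_field_set_integrable[OF test_field_mult[OF assms(1,2) test]]
    by (simp add: set_integrable_def)
  moreover have "integral\<^sup>L lborel ?g = 0"
    using weak[OF test] by (simp add: set_lebesgue_integral_def)
  ultimately have "AE z in lborel. ?g z = 0"
    using integral_nonneg_eq_0_iff_AE[of lborel ?g] nonneg by auto
  then have "AE z in lborel. z \<notin> ball z0 r"
    by eventually_elim (use pos in force)
  then have "ball z0 r \<in> null_sets lborel"
    by (subst AE_iff_null_sets) auto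
  then have "measure lborel (ball z0 r) = 0"
    by (simp add: measure_eq_0_null_sets)
  then show False using content_ball_pos[OF r(1), of z0] by simp
qed

lemma fundamental_lemma:
  fixes E :: "'a::euclidean_space \<Rightarrow> real"
  assumes "open S" "smooth_on S E"
    and weak: "\<And>\<phi>. test_field S \<phi> \<Longrightarrow> (LINT z:S|lborel. E z * \<phi> z) = 0"
    and "z0 \<in> S"
  shows "E z0 = 0"
proof -
  have "(LINT z:S|lborel. - E z * \<phi> z) = 0" if "test_field S \<phi>" for \<phi>
    using weak[OF that] by (simp add: set_lebesgue_integral_def)
  then have "- E z0 \<le> 0"
    by (intro fundamental_lemma_le[OF assms(1) smooth_on_minus[OF assms(1,2)] _ assms(4)])
  with fundamental_lemma_le[OF assms] show ?thesis by simp
qed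

section \<open>Partial derivatives in space-time\<close>

text \<open>The second-order difference over the parallelogram is the increment of \<open>?d\<close>
  over \<open>[0, h]\<close>. The mean value theorem along \<open>v\<close>, then along
  \<open>w\<close> for the derivative so obtained, yields the two parameters.\<close>

lemma mixed_difference_mean_value:
  fixes f :: "'a::real_normed_vector \<Rightarrow> real"
  assumes "smooth_on S f" "h > 0"
    and S: "\<And>s t. 0 \<le> s \<Longrightarrow> s \<le> h \<Longrightarrow> 0 \<le> t \<Longrightarrow> t \<le> h \<Longrightarrow> x + s *\<^sub>R v + t *\<^sub>R w \<in> S"
  shows "\<exists>s t. 0 \<le> s \<and> s \<le> h \<and> 0 \<le> t \<and> t \<le> h \<and>
    f (x + h *\<^sub>R v + h *\<^sub>R w) - f (x + h *\<^sub>R v) - f (x + h *\<^sub>R w) + f x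
      = h\<^sup>2 * frechet_derivative (\<lambda>y. frechet_derivative f (at y) v) (at (x + s *\<^sub>R v + t *\<^sub>R w)) w"
proof -
  let ?f' = "\<lambda>y. frechet_derivative f (at y) v"
  let ?f'' = "\<lambda>y. frechet_derivative ?f' (at y) w"
  have f: "((\<lambda>s. f (y + s *\<^sub>R v)) has_real_derivative ?f' (y + s *\<^sub>R v)) (at s)"
    if "y + s *\<^sub>R v \<in> S" for y s
    by (rule has_real_derivative_along_line[OF smooth_on_has_derivative[OF assms(1) that]])
  have f': "((\<lambda>t. ?f' (y + t *\<^sub>R w)) has_real_derivative ?f'' (y + t *\<^sub>R w)) (at t)"
    if "y + t *\<^sub>R w \<in> S" for y t
    by (rule has_real_derivative_along_line[OF smooth_on_has_derivative[OF
            smooth_on_frechet_derivative[OF assms(1)] that]])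
  let ?d = "\<lambda>s. f ((x + h *\<^sub>R w) + s *\<^sub>R v) - f (x + s *\<^sub>R v)"
  have "(?d has_real_derivative ?f' ((x + h *\<^sub>R w) + s *\<^sub>R v) - ?f' (x + s *\<^sub>R v)) (at s)"
    if "0 \<le> s" "s \<le> h" for s
    using S[of s h] S[of s 0] that assms(2) by (intro DERIV_diff f) (auto simp: algebra_simps)
  from MVT2[OF assms(2) this] obtain s where s: "0 < s" "s < h"
    and ds: "?d h - ?d 0 = (h - 0) * (?f' ((x + h *\<^sub>R w) + s *\<^sub>R v) - ?f' (x + s *\<^sub>R v))" by blast
  have "((\<lambda>t. ?f' ((x + s *\<^sub>R v) + t *\<^sub>R w)) has_real_derivative ?f'' ((x + s *\<^sub>R v) + t *\<^sub>R w)) (at t)"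
    if "0 \<le> t" "t \<le> h" for t
    using S[of s t] that s by (intro f') auto
  from MVT2[OF assms(2) this] obtain t where t: "0 < t" "t < h"
    and dt: "?f' ((x + s *\<^sub>R v) + h *\<^sub>R w) - ?f' ((x + s *\<^sub>R v) + 0 *\<^sub>R w) = (h - 0) * ?f'' ((x + s *\<^sub>R v) + t *\<^sub>R w)"
    by blast
  have "f (x + h *\<^sub>R v + h *\<^sub>R w) - f (x + h *\<^sub>R v) - f (x + h *\<^sub>R w) + f x = ?d h - ?d 0"
    by (simp add: algebra_simps)
  also have "\<dots> = h * (?f' ((x + s *\<^sub>R v) + h *\<^sub>R w) - ?f' ((x + s *\<^sub>R v) + 0 *\<^sub>R w))"
    unfolding ds by (simp add: algebra_simps)
  also have "\<dots> = h\<^sup>2 * ?f'' (x + s *\<^sub>R v + t *\<^sub>R w)"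
    unfolding dt by (simp add: power2_eq_square)
  finally show ?thesis using s t by (intro exI[of _ s] exI[of _ t]) simp
qed

text \<open>The second-order difference is symmetric in \<open>v\<close> and \<open>w\<close>, so
  the two iterated derivatives agree at a pair of points of a small parallelogram. Continuity at
  \<open>x\<close> then excludes a gap between their values there.\<close>

lemma frechet_derivative_commute:
  fixes f :: "'a::real_normed_vector \<Rightarrow> real"
  assumes "open S" "smooth_on S f" "x \<in> S"
  shows "frechet_derivative (\<lambda>y. frechet_derivative f (at y) v) (at x) w
    = frechet_derivative (\<lambda>y. frechet_derivative f (at y) w) (at x) v"
proof (rule ccontr)
  let ?A = "\<lambda>y. frechet_derivative (\<lambda>y. frechet_derivative f (at y) v) (at y) w"
  let ?B = "\<lambda>y. frechet_derivative (\<lambda>y. frechet_derivative f (at y) w) (at y) v"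
  assume neq: "?A x \<noteq> ?B x"
  \<comment> \<open>Half the gap: two values within \<open>e\<close> of \<open>?A x\<close> and
    \<open>?B x\<close> cannot coincide.\<close>
  define e where "e = \<bar>?A x - ?B x\<bar> / 2"
  have e: "e > 0" using neq by (simp add: e_def)
  have cont: "continuous_on S ?A" "continuous_on S ?B"
    by (intro smooth_on_continuous_on smooth_on_frechet_derivative assms(2))+
  obtain dA where dA: "dA > 0" "\<And>y. y \<in> S \<Longrightarrow> dist y x < dA \<Longrightarrow> dist (?A y) (?A x) < e"
    using cont(1) assms(3) e unfolding continuous_on_iff by meson
  obtain dB where dB: "dB > 0" "\<And>y. y \<in> S \<Longrightarrow> dist y x < dB \<Longrightarrow> dist (?B y) (?B x) < e"
    using cont(2) assms(3) e unfolding continuous_on_iff by meson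
  obtain dS where dS: "dS > 0" "ball x dS \<subseteq> S"
    using assms(1,3) unfolding open_contains_ball by blast
  define d where "d = min dS (min dA dB)"
  have d: "d > 0" using dA dB dS by (simp add: d_def)
  \<comment> \<open>The summand 1 keeps the denominator positive when both directions vanish, and it
    puts the whole parallelogram strictly inside the ball of radius \<open>d\<close>.\<close>
  define h where "h = d / (norm v + norm w + 1)"
  have N: "norm v + norm w + 1 > 0" by (simp add: add_nonneg_pos)
  then have h: "h > 0" using d by (simp add: h_def)
  have near: "dist (x + s *\<^sub>R v + t *\<^sub>R w) x < d" if "0 \<le> s" "s \<le> h" "0 \<le> t" "t \<le> h" for s t
  proof -
    have "dist (x + s *\<^sub>R v + t *\<^sub>R w) x \<le> s * norm v + t * norm w"
      using norm_triangle_ineq[of "s *\<^sub>R v" "t *\<^sub>R w"] that by (simp add: dist_norm add.assoc)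
    also have "\<dots> \<le> h * norm v + h * norm w"
      using that by (intro add_mono mult_right_mono) auto
    also have "\<dots> < h * (norm v + norm w + 1)" using h by (simp add: algebra_simps)
    also have "\<dots> = d" using N by (simp add: h_def)
    finally show ?thesis .
  qed
  have near': "dist (x + t *\<^sub>R w + s *\<^sub>R v) x < d" if "0 \<le> s" "s \<le> h" "0 \<le> t" "t \<le> h" for s t
    using near[OF that] by (simp add: add.commute add.left_commute add.assoc)
  have inS: "y \<in> S" if "dist y x < d" for y
    using that dS by (auto simp: d_def dist_commute)
  obtain s t where st: "0 \<le> s" "s \<le> h" "0 \<le> t" "t \<le> h"
    and A: "f (x + h *\<^sub>R v + h *\<^sub>R w) - f (x + h *\<^sub>R v) - f (x + h *\<^sub>R w) + f x
      = h\<^sup>2 * ?A (x + s *\<^sub>R v + t *\<^sub>R w)"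
    using mixed_difference_mean_value[OF assms(2) h, of x v w] near inS by blast
  obtain t' s' where st': "0 \<le> s'" "s' \<le> h" "0 \<le> t'" "t' \<le> h"
    and B: "f (x + h *\<^sub>R w + h *\<^sub>R v) - f (x + h *\<^sub>R w) - f (x + h *\<^sub>R v) + f x
      = h\<^sup>2 * ?B (x + t' *\<^sub>R w + s' *\<^sub>R v)"
    using mixed_difference_mean_value[OF assms(2) h, of x w v] near' inS by blast
  have "x + h *\<^sub>R w + h *\<^sub>R v = x + h *\<^sub>R v + h *\<^sub>R w" by simp
  then have "h\<^sup>2 * ?A (x + s *\<^sub>R v + t *\<^sub>R w) = h\<^sup>2 * ?B (x + t' *\<^sub>R w + s' *\<^sub>R v)"
    using A B[unfolded \<open>x + h *\<^sub>R w + h *\<^sub>R v = _\<close>] by linarith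
  then have eq: "?A (x + s *\<^sub>R v + t *\<^sub>R w) = ?B (x + t' *\<^sub>R w + s' *\<^sub>R v)" using h by simp
  have "dist (?A (x + s *\<^sub>R v + t *\<^sub>R w)) (?A x) < e"
    using near[OF st] by (intro dA inS) (auto simp: d_def)
  moreover have "dist (?B (x + t' *\<^sub>R w + s' *\<^sub>R v)) (?B x) < e"
    using near'[OF st'] by (intro dB inS) (auto simp: d_def)
  ultimately have "\<bar>?A x - ?B x\<bar> < 2 * e" using eq by (simp add: dist_real_def)
  then show False by (simp add: e_def)
qed

text \<open>For a jointly differentiable field the derivative of the time slice is the directional
  derivative along \<open>(1, 0)\<close>. Through this fact and its spatial counterpart the calculus
  of Frechet derivatives carries over to \<open>partial_t\<close> and
  \<open>partial_x\<close>.\<close>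

lemma partial_t_eq:
  assumes "f differentiable (at z)"
  shows "partial_t f z = frechet_derivative f (at z) (1, 0)"
proof -
  have f: "(f has_derivative frechet_derivative f (at z)) (at (fst z, snd z))"
    using assms by (simp add: frechet_derivative_works)
  have "((\<lambda>s. (s, snd z)) has_derivative (\<lambda>h. (h, 0))) (at (fst z))"
    by (auto intro!: derivative_eq_intros)
  note d = has_derivative_compose[OF this f]
  have "frechet_derivative f (at z) (h, 0) = h *\<^sub>R frechet_derivative f (at z) (1, 0)" for h
    using linear_scale[OF linear_frechet_derivative[OF assms], of h "(1, 0)"] by simp
  then have "((\<lambda>s. f (s, snd z)) has_vector_derivative frechet_derivative f (at z) (1, 0)) (at (fst z))"
    unfolding has_vector_derivative_def by (intro has_derivative_eq_rhs[OF d] ext)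
  then show ?thesis by (simp add: partial_t_def vector_derivative_at)
qed

lemma partial_x_eq:
  assumes "f differentiable (at z)"
  shows "partial_x i f z = frechet_derivative f (at z) (0, axis i 1)"
proof -
  have f: "(f has_derivative frechet_derivative f (at z)) (at (fst z, snd z))"
    using assms by (simp add: frechet_derivative_works)
  have "((\<lambda>y. (fst z, y)) has_derivative (\<lambda>h. (0, h))) (at (snd z))"
    by (auto intro!: derivative_eq_intros)
  note d = has_derivative_compose[OF this f]
  then show ?thesis
    by (simp add: partial_x_def pderiv_vec_def frechet_derivative_at[OF d, symmetric])
qed

lemma grad_x_nth: "grad_x f z $ i = partial_x i f z"
  by (simp add: grad_x_def gradient_def partial_x_def)

lemma smooth_on_partial_t:
  assumes "open D" "smooth_on D f"
  shows "smooth_on D (partial_t f)"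
  by (rule smooth_on_cong[OF smooth_on_frechet_derivative[OF assms(2), of "(1, 0)"] assms(1)])
    (simp add: partial_t_eq smooth_on_differentiable[OF assms(2)])

lemma smooth_on_partial_x:
  assumes "open D" "smooth_on D f"
  shows "smooth_on D (partial_x i f)"
  by (rule smooth_on_cong[OF smooth_on_frechet_derivative[OF assms(2), of "(0, axis i 1)"] assms(1)])
    (simp add: partial_x_eq smooth_on_differentiable[OF assms(2)])

text \<open>The inner partial derivative is first replaced by a directional derivative on all of
  \<open>D\<close>, since the outer one depends on a neighbourhood of \<open>z\<close>; symmetry of
  second derivatives then applies.\<close>

lemma partial_x_commute:
  fixes f :: "'d::finite spacetime \<Rightarrow> real"
  assumes "open D" "smooth_on D f" "z \<in> D"
  shows "partial_x i (partial_x k f) z = partial_x k (partial_x i f) z"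
    and "partial_x i (partial_t f) z = partial_t (partial_x i f) z"
proof -
  note f = smooth_on_differentiable[OF assms(2)]
  have d: "partial_x i (partial_x k f) z = frechet_derivative (\<lambda>y. frechet_derivative f (at y) (0, axis k 1)) (at z) (0, axis i 1)"
    for i k
    using frechet_derivative_cong_open[OF assms(1,3), of "partial_x k f" "\<lambda>y. frechet_derivative f (at y) (0, axis k 1)"]
    by (simp add: partial_x_eq[OF smooth_on_differentiable[OF smooth_on_partial_x[OF assms(1,2)] assms(3)]]
        partial_x_eq[OF f])
  show "partial_x i (partial_x k f) z = partial_x k (partial_x i f) z"
    unfolding d by (rule frechet_derivative_commute[OF assms])
  have "partial_x i (partial_t f) z = frechet_derivative (\<lambda>y. frechet_derivative f (at y) (1, 0)) (at z) (0, axis i 1)"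
    using frechet_derivative_cong_open[OF assms(1,3), of "partial_t f" "\<lambda>y. frechet_derivative f (at y) (1, 0)"]
    by (simp add: partial_x_eq[OF smooth_on_differentiable[OF smooth_on_partial_t[OF assms(1,2)] assms(3)]]
        partial_t_eq[OF f])
  also have "\<dots> = frechet_derivative (\<lambda>y. frechet_derivative f (at y) (0, axis i 1)) (at z) (1, 0)"
    by (rule frechet_derivative_commute[OF assms])
  also have "\<dots> = partial_t (partial_x i f) z"
    using frechet_derivative_cong_open[OF assms(1,3), of "partial_x i f" "\<lambda>y. frechet_derivative f (at y) (0, axis i 1)"]
    by (simp add: partial_t_eq[OF smooth_on_differentiable[OF smooth_on_partial_x[OF assms(1,2)] assms(3)]]
        partial_x_eq[OF f])
  finally show "partial_x i (partial_t f) z = partial_t (partial_x i f) z" .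
qed

section \<open>Calculus rules for partial derivatives\<close>

lemma partial_add:
  assumes "f differentiable (at z)" "g differentiable (at z)"
  shows "partial_t (\<lambda>y. f y + g y) z = partial_t f z + partial_t g z"
    and "partial_x i (\<lambda>y. f y + g y) z = partial_x i f z + partial_x i g z"
  by (simp_all add: partial_t_eq partial_x_eq assms
      fun_cong[OF frechet_derivative_at[OF has_derivative_add[OF assms[unfolded frechet_derivative_works]]], symmetric])

lemma partial_diff:
  assumes "f differentiable (at z)" "g differentiable (at z)"
  shows "partial_t (\<lambda>y. f y - g y) z = partial_t f z - partial_t g z"
    and "partial_x i (\<lambda>y. f y - g y) z = partial_x i f z - partial_x i g z"
  by (simp_all add: partial_t_eq partial_x_eq assms
      fun_cong[OF frechet_derivative_at[OF has_derivative_diff[OF assms[unfolded frechet_derivative_works]]], symmetric])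

lemma partial_mult:
  fixes f g :: "'d::finite spacetime \<Rightarrow> real"
  assumes "f differentiable (at z)" "g differentiable (at z)"
  shows "partial_t (\<lambda>y. f y * g y) z = partial_t f z * g z + f z * partial_t g z"
    and "partial_x i (\<lambda>y. f y * g y) z = partial_x i f z * g z + f z * partial_x i g z"
  by (simp_all add: partial_t_eq partial_x_eq assms
      fun_cong[OF frechet_derivative_at[OF has_derivative_mult[OF assms[unfolded frechet_derivative_works]]], symmetric])

lemma partial_sum:
  assumes "\<And>k. k \<in> I \<Longrightarrow> f k differentiable (at z)"
  shows "partial_t (\<lambda>y. \<Sum>k\<in>I. f k y) z = (\<Sum>k\<in>I. partial_t (f k) z)"
    and "partial_x i (\<lambda>y. \<Sum>k\<in>I. f k y) z = (\<Sum>k\<in>I. partial_x i (f k) z)"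
proof -
  have d: "((\<lambda>y. \<Sum>k\<in>I. f k y) has_derivative (\<lambda>h. \<Sum>k\<in>I. frechet_derivative (f k) (at z) h)) (at z)"
    using assms(1) by (intro has_derivative_sum) (simp add: frechet_derivative_works)
  then have "(\<lambda>y. \<Sum>k\<in>I. f k y) differentiable (at z)" by (auto simp: differentiable_def)
  then show "partial_t (\<lambda>y. \<Sum>k\<in>I. f k y) z = (\<Sum>k\<in>I. partial_t (f k) z)"
    and "partial_x i (\<lambda>y. \<Sum>k\<in>I. f k y) z = (\<Sum>k\<in>I. partial_x i (f k) z)"
    by (simp_all add: partial_t_eq partial_x_eq assms(1) fun_cong[OF frechet_derivative_at[OF d], symmetric])
qed

lemma partial_nth:
  assumes "f differentiable (at z)"
  shows "partial_t (\<lambda>y. f y $ k) z = partial_t f z $ k"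
    and "partial_x i (\<lambda>y. f y $ k) z = partial_x i f z $ k"
proof -
  note d = bounded_linear.has_derivative[OF bounded_linear_vec_nth assms[unfolded frechet_derivative_works], of k]
  then have "(\<lambda>y. f y $ k) differentiable (at z)" by (auto simp: differentiable_def)
  then show "partial_t (\<lambda>y. f y $ k) z = partial_t f z $ k"
    and "partial_x i (\<lambda>y. f y $ k) z = partial_x i f z $ k"
    by (simp_all add: partial_t_eq partial_x_eq assms fun_cong[OF frechet_derivative_at[OF d], symmetric])
qed

lemma partial_scaleR_const:
  assumes "f differentiable (at z)"
  shows "partial_t (\<lambda>y. f y *\<^sub>R c) z = partial_t f z *\<^sub>R c"
    and "partial_x i (\<lambda>y. f y *\<^sub>R c) z = partial_x i f z *\<^sub>R c"
  by (simp_all add: partial_t_eq partial_x_eq assms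
      fun_cong[OF frechet_derivative_at[OF has_derivative_scaleR_left[OF assms[unfolded frechet_derivative_works]]], symmetric])

lemma partial_const [simp]: "partial_t (\<lambda>y. c) z = 0" "partial_x i (\<lambda>y. c) z = 0"
  by (simp_all add: partial_t_def partial_x_def pderiv_vec_def)

text \<open>By the product rule the weak integrand is \<open>E \<phi>\<close> plus the space-time
  divergence of the field with components \<open>B \<phi>\<close> and \<open>C k \<phi>\<close>.
  These are test fields, so the divergence integrates to zero and the fundamental lemma applies to
  \<open>E\<close>. Both kinds of variation are brought to this form.\<close>

lemma weak_conservation_law:
  fixes A B :: "'d::finite spacetime \<Rightarrow> real" and C :: "'d \<Rightarrow> 'd spacetime \<Rightarrow> real"
  assumes "open D" and smooth: "smooth_on D A" "smooth_on D B" "\<And>k. smooth_on D (C k)"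
    and weak: "\<And>\<phi>. test_field D \<phi> \<Longrightarrow>
      (LINT z:D|lborel. A z * \<phi> z + B z * partial_t \<phi> z + (\<Sum>k\<in>UNIV. C k z * partial_x k \<phi> z)) = 0"
    and "z0 \<in> D"
  shows "A z0 = partial_t B z0 + (\<Sum>k\<in>UNIV. partial_x k (C k) z0)"
proof -
  define E where "E z = A z - partial_t B z - (\<Sum>k\<in>UNIV. partial_x k (C k) z)" for z
  have sE: "smooth_on D E"
    unfolding E_def
    by (intro smooth_on_diff smooth_on_sum smooth_on_partial_t smooth_on_partial_x assms(1) smooth) simp
  have "(LINT z:D|lborel. E z * \<phi> z) = 0" if \<phi>: "test_field D \<phi>" for \<phi>
  proof -
    let ?T = "\<lambda>z. A z * \<phi> z + B z * partial_t \<phi> z + (\<Sum>k\<in>UNIV. C k z * partial_x k \<phi> z)"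
    let ?dt = "\<lambda>z. frechet_derivative (\<lambda>z. B z * \<phi> z) (at z) (1, 0)"
    let ?dx = "\<lambda>k z. frechet_derivative (\<lambda>z. C k z * \<phi> z) (at z) (0, axis k 1)"
    have tB: "test_field D (\<lambda>z. B z * \<phi> z)" and tC: "test_field D (\<lambda>z. C k z * \<phi> z)" for k
      by (rule test_field_mult[OF assms(1) smooth(2) \<phi>] test_field_mult[OF assms(1) smooth(3) \<phi>])+
    note it = test_field_set_integrable[OF test_field_frechet_derivative[OF assms(1) tB], of "(1, 0)"]
      and ix = test_field_set_integrable[OF test_field_frechet_derivative[OF assms(1) tC], of _ "(0, axis k 1)" for k]
      and iE = test_field_set_integrable[OF test_field_mult[OF assms(1) sE \<phi>]]
    have T: "?T z = E z * \<phi> z + (?dt z + (\<Sum>k\<in>UNIV. ?dx k z))" if "z \<in> D" for z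
    proof -
      note d = smooth_on_differentiable[OF smooth(2) that] smooth_on_differentiable[OF smooth(3) that]
        smooth_on_differentiable[OF test_field_smooth_on[OF \<phi>] that]
      have "?dt z = partial_t (\<lambda>z. B z * \<phi> z) z" "?dx k z = partial_x k (\<lambda>z. C k z * \<phi> z) z" for k
        using d by (simp_all add: partial_t_eq partial_x_eq)
      then show ?thesis
        using d by (simp add: E_def partial_mult sum.distrib sum_distrib_left algebra_simps)
    qed
    have ixs: "set_integrable lborel D (\<lambda>z. \<Sum>k\<in>UNIV. ?dx k z)"
      using ix unfolding set_integrable_def scaleR_sum_right
      by (intro Bochner_Integration.integrable_sum)
    have "0 = (LINT z:D|lborel. ?T z)" using weak[OF \<phi>] by simp
    also have "\<dots> = (LINT z:D|lborel. E z * \<phi> z + (?dt z + (\<Sum>k\<in>UNIV. ?dx k z)))"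
      using T assms(1) by (intro set_lebesgue_integral_cong) auto
    also have "\<dots> = (LINT z:D|lborel. E z * \<phi> z) + ((LINT z:D|lborel. ?dt z) + (LINT z:D|lborel. \<Sum>k\<in>UNIV. ?dx k z))"
      using it ixs iE by (simp add: set_integral_add)
    also have "(LINT z:D|lborel. ?dt z) = 0"
      by (rule set_integral_frechet_derivative_test_field[OF assms(1) tB])
    also have "(LINT z:D|lborel. \<Sum>k\<in>UNIV. ?dx k z) = (\<Sum>k\<in>UNIV. LINT z:D|lborel. ?dx k z)"
      using ix unfolding set_integrable_def set_lebesgue_integral_def scaleR_sum_right
      by (intro Bochner_Integration.integral_sum)
    also have "\<dots> = 0"
      by (simp add: set_integral_frechet_derivative_test_field[OF assms(1) tC])
    finally show ?thesis by simp
  qed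
  then have "E z0 = 0" by (rule fundamental_lemma[OF assms(1) sE _ assms(6)])
  then show ?thesis by (simp add: E_def)
qed

section \<open>Derivatives of the Lagrangians\<close>

lemma linear_vec_expansion:
  fixes T :: "real^'n \<Rightarrow> real"
  assumes "linear T"
  shows "T v = (\<Sum>k\<in>UNIV. T (axis k 1) * v $ k)"
proof -
  have "T v = T (\<Sum>k\<in>UNIV. v $ k *\<^sub>R axis k 1)"
    using basis_expansion[of v] by (simp add: scalar_mult_eq_scaleR)
  also have "\<dots> = (\<Sum>k\<in>UNIV. T (axis k 1) * v $ k)"
    using linear_sum[OF assms, of "\<lambda>k. v $ k *\<^sub>R axis k 1" UNIV] linear_scale[OF assms]
    by (simp add: mult.commute)
  finally show ?thesis .
qed

lemma frechet_derivative_compose_at: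
  assumes "(p has_derivative q) (at x)" "f differentiable (at (p x))"
  shows "frechet_derivative (\<lambda>y. f (p y)) (at x) v = frechet_derivative f (at (p x)) (q v)"
  using has_derivative_compose[OF assms(1) assms(2)[unfolded frechet_derivative_works]]
  by (simp add: frechet_derivative_at[symmetric])

lemma dL_eq_frechet_derivative:
  fixes L :: "('d::finite, 'n::finite, 'p::finite, 'm::finite) slots \<Rightarrow> real"
  assumes "L differentiable (at a)"
  shows "dL_mass L a = frechet_derivative L (at a) (1, 0, 0, 0, 0, 0, 0)"
    and "dL_vel L a $ k = frechet_derivative L (at a) (0, axis k 1, 0, 0, 0, 0, 0)"
    and "dL_own i L a = frechet_derivative L (at a) (0, 0, axis i 1, 0, 0, 0, 0)"
    and "dL_other l L a = frechet_derivative L (at a) (0, 0, 0, axis l 1, 0, 0, 0)"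
    and "dL_xi j L a = frechet_derivative L (at a) (0, 0, 0, 0, axis j 1, 0, 0)"
    and "dL_grad j L a $ k = frechet_derivative L (at a) (0, 0, 0, 0, 0, axis j (axis k 1), 0)"
    and "dL_mat j L a = frechet_derivative L (at a) (0, 0, 0, 0, 0, 0, axis j 1)"
proof -
  obtain m u b c x g w where a: "a = (m, u, b, c, x, g, w)" by (metis prod.exhaust)
  have "((\<lambda>s. (s, u, b, c, x, g, w)) has_derivative (\<lambda>s. (s, 0, 0, 0, 0, 0, 0))) (at m)"
    by (auto intro!: derivative_eq_intros simp: zero_prod_def)
  from has_derivative_compose[OF this] assms
  have d: "((\<lambda>s. L (s, u, b, c, x, g, w)) has_derivative
      (\<lambda>s. frechet_derivative L (at a) (s, 0, 0, 0, 0, 0, 0))) (at m)"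
    by (simp add: a frechet_derivative_works)
  have "frechet_derivative L (at a) (s, 0, 0, 0, 0, 0, 0) = frechet_derivative L (at a) (1, 0, 0, 0, 0, 0, 0) * s" for s
    using linear_scale[OF linear_frechet_derivative[OF assms], of s "(1, 0, 0, 0, 0, 0, 0)"]
    by (simp add: mult.commute)
  then have "((\<lambda>s. L (s, u, b, c, x, g, w)) has_real_derivative frechet_derivative L (at a) (1, 0, 0, 0, 0, 0, 0)) (at m)"
    unfolding has_field_derivative_def by (intro has_derivative_eq_rhs[OF d] ext)
  then show "dL_mass L a = frechet_derivative L (at a) (1, 0, 0, 0, 0, 0, 0)"
    by (simp add: dL_mass_def a DERIV_imp_deriv)
  have "((\<lambda>v. (m, v, b, c, x, g, w)) has_derivative (\<lambda>v. (0, v, 0, 0, 0, 0, 0))) (at u)"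
    by (auto intro!: derivative_eq_intros simp: zero_prod_def)
  from frechet_derivative_compose_at[OF this, of L] assms
  show "dL_vel L a $ k = frechet_derivative L (at a) (0, axis k 1, 0, 0, 0, 0, 0)"
    by (simp add: a dL_vel_def gradient_def pderiv_vec_def)
  have "((\<lambda>v. (m, u, v, c, x, g, w)) has_derivative (\<lambda>v. (0, 0, v, 0, 0, 0, 0))) (at b)"
    by (auto intro!: derivative_eq_intros simp: zero_prod_def)
  from frechet_derivative_compose_at[OF this, of L] assms
  show "dL_own i L a = frechet_derivative L (at a) (0, 0, axis i 1, 0, 0, 0, 0)"
    by (simp add: a dL_own_def pderiv_vec_def)
  have "((\<lambda>v. (m, u, b, v, x, g, w)) has_derivative (\<lambda>v. (0, 0, 0, v, 0, 0, 0))) (at c)"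
    by (auto intro!: derivative_eq_intros simp: zero_prod_def)
  from frechet_derivative_compose_at[OF this, of L] assms
  show "dL_other l L a = frechet_derivative L (at a) (0, 0, 0, axis l 1, 0, 0, 0)"
    by (simp add: a dL_other_def pderiv_vec_def)
  have "((\<lambda>v. (m, u, b, c, v, g, w)) has_derivative (\<lambda>v. (0, 0, 0, 0, v, 0, 0))) (at x)"
    by (auto intro!: derivative_eq_intros simp: zero_prod_def)
  from frechet_derivative_compose_at[OF this, of L] assms
  show "dL_xi j L a = frechet_derivative L (at a) (0, 0, 0, 0, axis j 1, 0, 0)"
    by (simp add: a dL_xi_def pderiv_vec_def)
  \<comment> \<open>\<open>dL_grad\<close> varies one row of the gradient slot. Replacing row
    \<open>j\<close> is an affine map with linear part \<open>axis j\<close>, and inserting the old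
    row \<open>g $ j\<close> gives back \<open>g\<close>, so the total derivative is taken at the
    right point.\<close>
  have "((\<lambda>v. if l = j then v else g $ l) has_derivative (\<lambda>v. if l = j then v else 0)) (at (g $ j))" for l
    by (cases "l = j") simp_all
  then have "((\<lambda>v. \<chi> l. if l = j then v else g $ l) has_derivative (\<lambda>v. \<chi> l. if l = j then v else 0)) (at (g $ j))"
    by (rule has_derivative_vec_lambda)
  then have "((\<lambda>v. (m, u, b, c, x, \<chi> l. if l = j then v else g $ l, w)) has_derivative
      (\<lambda>v. (0, 0, 0, 0, 0, axis j v, 0))) (at (g $ j))"
    by (auto intro!: derivative_eq_intros simp: axis_def zero_prod_def)
  moreover have "(\<chi> l. if l = j then g $ j else g $ l) = g" by (simp add: vec_eq_iff)
  ultimately show "dL_grad j L a $ k = frechet_derivative L (at a) (0, 0, 0, 0, 0, axis j (axis k 1), 0)"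
    using frechet_derivative_compose_at[of _ _ "g $ j" L] assms
    by (simp add: a dL_grad_def gradient_def pderiv_vec_def)
  have "((\<lambda>v. (m, u, b, c, x, g, v)) has_derivative (\<lambda>v. (0, 0, 0, 0, 0, 0, v))) (at w)"
    by (auto intro!: derivative_eq_intros simp: zero_prod_def)
  from frechet_derivative_compose_at[OF this, of L] assms
  show "dL_mat j L a = frechet_derivative L (at a) (0, 0, 0, 0, 0, 0, axis j 1)"
    by (simp add: a dL_mat_def pderiv_vec_def)
qed

text \<open>Linearity of the total derivative: the increment is split into its seven slots, each is
  expanded in its standard basis, and the gradient slot is expanded twice, over rows and then over
  entries. This is the algebraic half of the chain rule for \<open>L\<close> along the
  fields.\<close>

lemma frechet_derivative_slots:
  fixes L :: "('d::finite, 'n::finite, 'p::finite, 'm::finite) slots \<Rightarrow> real"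
  assumes "L differentiable (at a)"
  shows "frechet_derivative L (at a) (dm, du, db, dc, dx, dg, dw) =
      dL_mass L a * dm + (\<Sum>k\<in>UNIV. dL_vel L a $ k * du $ k) + (\<Sum>i\<in>UNIV. dL_own i L a * db $ i)
    + (\<Sum>i\<in>UNIV. dL_other i L a * dc $ i) + (\<Sum>j\<in>UNIV. dL_xi j L a * dx $ j)
    + (\<Sum>j\<in>UNIV. \<Sum>k\<in>UNIV. dL_grad j L a $ k * dg $ j $ k) + (\<Sum>j\<in>UNIV. dL_mat j L a * dw $ j)"
proof -
  let ?T = "frechet_derivative L (at a)"
  have lin: "linear ?T" by (rule linear_frechet_derivative[OF assms])
  have comp: "linear (\<lambda>v. ?T (q v))" if "linear q" for q :: "'z::real_vector \<Rightarrow> _"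
    using linear_compose[OF that lin] by (simp add: o_def)
  have "(dm, du, db, dc, dx, dg, dw) = (dm, 0, 0, 0, 0, 0, 0) + (0, du, 0, 0, 0, 0, 0) + (0, 0, db, 0, 0, 0, 0)
      + (0, 0, 0, dc, 0, 0, 0) + (0, 0, 0, 0, dx, 0, 0) + (0, 0, 0, 0, 0, dg, 0) + (0, 0, 0, 0, 0, 0, dw)"
    by simp
  then have "?T (dm, du, db, dc, dx, dg, dw) = ?T (dm, 0, 0, 0, 0, 0, 0) + ?T (0, du, 0, 0, 0, 0, 0)
      + ?T (0, 0, db, 0, 0, 0, 0) + ?T (0, 0, 0, dc, 0, 0, 0) + ?T (0, 0, 0, 0, dx, 0, 0)
      + ?T (0, 0, 0, 0, 0, dg, 0) + ?T (0, 0, 0, 0, 0, 0, dw)"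
    by (simp only: linear_add[OF lin])
  moreover have "?T (dm, 0, 0, 0, 0, 0, 0) = dL_mass L a * dm"
    using linear_scale[OF lin, of dm "(1, 0, 0, 0, 0, 0, 0)"]
    by (simp add: dL_eq_frechet_derivative[OF assms] mult.commute)
  moreover have "?T (0, du, 0, 0, 0, 0, 0) = (\<Sum>k\<in>UNIV. dL_vel L a $ k * du $ k)"
    unfolding dL_eq_frechet_derivative[OF assms]
    by (rule linear_vec_expansion, rule comp) (auto intro!: linearI)
  moreover have "?T (0, 0, db, 0, 0, 0, 0) = (\<Sum>i\<in>UNIV. dL_own i L a * db $ i)"
    unfolding dL_eq_frechet_derivative[OF assms]
    by (rule linear_vec_expansion, rule comp) (auto intro!: linearI)
  moreover have "?T (0, 0, 0, dc, 0, 0, 0) = (\<Sum>i\<in>UNIV. dL_other i L a * dc $ i)"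
    unfolding dL_eq_frechet_derivative[OF assms]
    by (rule linear_vec_expansion, rule comp) (auto intro!: linearI)
  moreover have "?T (0, 0, 0, 0, dx, 0, 0) = (\<Sum>j\<in>UNIV. dL_xi j L a * dx $ j)"
    unfolding dL_eq_frechet_derivative[OF assms]
    by (rule linear_vec_expansion, rule comp) (auto intro!: linearI)
  moreover have "?T (0, 0, 0, 0, 0, dg, 0) = (\<Sum>j\<in>UNIV. \<Sum>k\<in>UNIV. dL_grad j L a $ k * dg $ j $ k)"
  proof -
    have lg: "linear (\<lambda>g. ?T (0, 0, 0, 0, 0, g, 0))" by (rule comp) (auto intro!: linearI)
    have "?T (0, 0, 0, 0, 0, dg, 0) = (\<Sum>j\<in>UNIV. ?T (0, 0, 0, 0, 0, axis j (dg $ j), 0))"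
      using linear_sum[OF lg, of "\<lambda>j. axis j (dg $ j)" UNIV] by (simp add: sum_axis vec_nth_inverse)
    also have "\<dots> = (\<Sum>j\<in>UNIV. \<Sum>k\<in>UNIV. dL_grad j L a $ k * dg $ j $ k)"
      unfolding dL_eq_frechet_derivative[OF assms]
      by (rule sum.cong[OF refl], rule linear_vec_expansion, rule comp)
        (auto intro!: linearI simp: axis_def vec_eq_iff)
    finally show ?thesis .
  qed
  moreover have "?T (0, 0, 0, 0, 0, 0, dw) = (\<Sum>j\<in>UNIV. dL_mat j L a * dw $ j)"
    unfolding dL_eq_frechet_derivative[OF assms]
    by (rule linear_vec_expansion, rule comp) (auto intro!: linearI)
  ultimately show ?thesis by simp
qed

lemma smooth_on_dL:
  fixes L :: "('d::finite, 'n::finite, 'p::finite, 'm::finite) slots \<Rightarrow> real"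
  assumes "open U" "smooth_on U L"
  shows "smooth_on U (dL_mass L)" "smooth_on U (dL_vel L)" "smooth_on U (dL_own i L)"
    "smooth_on U (dL_other l L)" "smooth_on U (dL_xi j L)" "smooth_on U (dL_grad j L)" "smooth_on U (dL_mat j L)"
proof -
  note L = smooth_on_differentiable[OF assms(2)]
  have scalar: "smooth_on U f" if "\<And>a. a \<in> U \<Longrightarrow> f a = frechet_derivative L (at a) v" for f v
    by (rule smooth_on_cong[OF smooth_on_frechet_derivative[OF assms(2), of v] assms(1)]) (simp add: that)
  have vector: "smooth_on U f" if "\<And>a k. a \<in> U \<Longrightarrow> f a $ k = frechet_derivative L (at a) (v k)"
    for f :: "_ \<Rightarrow> real^'d" and v
  proof -
    have "smooth_on U (\<lambda>a. \<chi> k. f a $ k)"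
      by (rule smooth_on_vec_lambda[OF assms(1)], rule scalar, erule that)
    then show ?thesis by simp
  qed
  show "smooth_on U (dL_mass L)" "smooth_on U (dL_own i L)"
    "smooth_on U (dL_other l L)" "smooth_on U (dL_xi j L)" "smooth_on U (dL_mat j L)"
    by (rule scalar, erule dL_eq_frechet_derivative[OF L])+
  show "smooth_on U (dL_vel L)" "smooth_on U (dL_grad j L)"
    by (rule vector, erule dL_eq_frechet_derivative[OF L])+
qed

section \<open>Variations\<close>

lemma smooth_on_grad_x:
  assumes "open D" "smooth_on D f"
  shows "smooth_on D (grad_x f)"
proof -
  have "grad_x f = (\<lambda>z. \<chi> i. partial_x i f z)" by (simp add: fun_eq_iff vec_eq_iff grad_x_nth)
  then show ?thesis using smooth_on_vec_lambda[OF assms(1) smooth_on_partial_x[OF assms]] by simp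
qed

lemma smooth_on_material:
  assumes "open D" "smooth_on D u" "smooth_on D f"
  shows "smooth_on D (material u f)"
  unfolding material_def[abs_def]
  by (intro smooth_on_add smooth_on_sum smooth_on_scaleR smooth_on_vec_nth smooth_on_partial_t
      smooth_on_partial_x assms) simp

lemma smooth_on_slots_along:
  assumes "open D" "smooth_on D m" "smooth_on D u" "\<And>i. smooth_on D (b i)" "\<And>i. smooth_on D (c i)"
    "\<And>j. smooth_on D (\<xi> j)"
  shows "smooth_on D (slots_along m u b c \<xi>)"
  unfolding slots_along_def[abs_def]
  by (intro smooth_on_Pair smooth_on_vec_lambda smooth_on_grad_x smooth_on_material assms)

text \<open>Chain rule along the fields. The last two slots already hold first derivatives of the
  \<open>\<xi> j\<close>, which is where second derivatives enter the momentum balance.\<close>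

lemma partial_x_lagrangian:
  fixes L :: "('d::finite, 'n::finite, 'p::finite, 'm::finite) slots \<Rightarrow> real"
    and m :: "'d spacetime \<Rightarrow> real" and u :: "'d spacetime \<Rightarrow> real^'d"
    and b :: "'n \<Rightarrow> 'd spacetime \<Rightarrow> real" and c :: "'p \<Rightarrow> 'd spacetime \<Rightarrow> real"
    and \<xi> :: "'m \<Rightarrow> 'd spacetime \<Rightarrow> real"
  assumes "open D" "smooth_on D m" "smooth_on D u" "\<And>i. smooth_on D (b i)" "\<And>i. smooth_on D (c i)"
    "\<And>j. smooth_on D (\<xi> j)" "z \<in> D" "L differentiable (at (slots_along m u b c \<xi> z))"
  defines "a \<equiv> slots_along m u b c \<xi>"
  shows "partial_x i (\<lambda>y. L (a y)) z =
      dL_mass L (a z) * partial_x i m z + (\<Sum>k\<in>UNIV. dL_vel L (a z) $ k * partial_x i u z $ k)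
    + (\<Sum>l\<in>UNIV. dL_own l L (a z) * partial_x i (b l) z) + (\<Sum>l\<in>UNIV. dL_other l L (a z) * partial_x i (c l) z)
    + (\<Sum>j\<in>UNIV. dL_xi j L (a z) * partial_x i (\<xi> j) z)
    + (\<Sum>j\<in>UNIV. \<Sum>k\<in>UNIV. dL_grad j L (a z) $ k * partial_x i (partial_x k (\<xi> j)) z)
    + (\<Sum>j\<in>UNIV. dL_mat j L (a z) * partial_x i (material u (\<xi> j)) z)"
proof -
  let ?e = "(0, axis i 1) :: real \<times> (real^'d)"
  let ?fd = "\<lambda>f. frechet_derivative f (at z)"
  note sm = smooth_on_has_derivative[OF _ assms(7)]
  have g: "smooth_on D (grad_x (\<xi> j))" and w: "smooth_on D (material u (\<xi> j))" for j
    by (intro smooth_on_grad_x smooth_on_material assms)+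
  have da: "(a has_derivative (\<lambda>v. (?fd m v, ?fd u v, \<chi> i. ?fd (b i) v, \<chi> i. ?fd (c i) v, \<chi> j. ?fd (\<xi> j) v,
      \<chi> j. ?fd (grad_x (\<xi> j)) v, \<chi> j. ?fd (material u (\<xi> j)) v))) (at z)"
    unfolding a_def slots_along_def[abs_def]
    by (intro has_derivative_Pair has_derivative_vec_lambda sm assms g w)
  have dL: "L differentiable (at (a z))" using assms(8) by (simp add: a_def)
  have "(\<lambda>y. L (a y)) differentiable (at z)"
    using has_derivative_compose[OF da dL[unfolded frechet_derivative_works]] by (auto simp: differentiable_def)
  then have "partial_x i (\<lambda>y. L (a y)) z = frechet_derivative L (at (a z)) (?fd m ?e, ?fd u ?e,
      \<chi> i. ?fd (b i) ?e, \<chi> i. ?fd (c i) ?e, \<chi> j. ?fd (\<xi> j) ?e, \<chi> j. ?fd (grad_x (\<xi> j)) ?e,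
      \<chi> j. ?fd (material u (\<xi> j)) ?e)"
    by (simp add: partial_x_eq frechet_derivative_compose_at[OF da dL])
  moreover have "partial_x i (grad_x (\<xi> j)) z $ k = partial_x i (partial_x k (\<xi> j)) z" for j k
  proof -
    have "partial_x i (partial_x k (\<xi> j)) z = partial_x i (\<lambda>y. grad_x (\<xi> j) y $ k) z"
      by (simp add: grad_x_nth)
    then show ?thesis
      by (simp add: partial_nth smooth_on_differentiable[OF g assms(7)])
  qed
  ultimately show ?thesis
    using assms(2-6) g w
    by (simp add: frechet_derivative_slots[OF dL]
        partial_x_eq[OF smooth_on_differentiable[OF _ assms(7)], symmetric])
qed

text \<open>The two transposes cancel: the matrix is the Jacobian, and applied to \<open>v\<close>
  it gives the derivative of \<open>u\<close> in the direction \<open>v\<close>.\<close>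

lemma transpose_Grad_x_mult_nth:
  "(transpose (Grad_x u z) *v v) $ k = (\<Sum>i\<in>UNIV. partial_x i u z $ k * v $ i)"
  by (simp add: Grad_x_def jacobian_def matrix_def matrix_vector_mult_def partial_x_def pderiv_vec_def)

section \<open>Variations for special test fields\<close>

lemma delta_b_zero [simp]: "delta_b b (\<lambda>y. 0) z = 0"
  by (simp add: delta_b_def)

lemma delta_u_zero [simp]: "delta_u u (\<lambda>y. 0) z = 0"
  by (simp add: delta_u_def material_def)

lemma delta_m_zero [simp]: "delta_m m (\<lambda>y. 0) z = 0"
  by (simp add: delta_m_def div_x_def)

lemma delta_material_zero [simp]: "delta_material u \<xi> \<Phi> (\<lambda>y. 0) z = grad_x \<xi> z \<bullet> delta_u u \<Phi> z"
  by (simp add: delta_material_def material_def)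

lemma grad_x_zero [simp]: "grad_x (\<lambda>y. 0) z = 0"
  by (simp add: vec_eq_iff grad_x_nth)

text \<open>What a phase at rest feels when the other one is displaced: only the transported fields
  \<open>c\<close> vary. This produces the coupling terms between the two momentum
  equations.\<close>

lemma delta_L_other_displacement:
  "delta_L L m u b c \<xi> (\<lambda>y. 0) \<Psi> (\<lambda>j y. 0) z
    = (\<Sum>i\<in>UNIV. dL_other i L (slots_along m u b c \<xi> z) * delta_b (c i) \<Psi> z)"
  by (simp add: delta_L_def Let_def)

lemma delta_m_axis:
  assumes "m differentiable (at z)" "\<phi> differentiable (at z)"
  shows "delta_m m (\<lambda>y. \<phi> y *\<^sub>R axis i 1) z = - (partial_x i m z * \<phi> z + m z * partial_x i \<phi> z)"
proof -
  have "(m y *\<^sub>R \<phi> y *\<^sub>R axis i 1) $ k = (if k = i then m y * \<phi> y else 0)" for y k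
    by (simp add: axis_def)
  then have "partial_x k (\<lambda>y. (m y *\<^sub>R \<phi> y *\<^sub>R axis i 1) $ k) z = (if k = i then partial_x i (\<lambda>y. m y * \<phi> y) z else 0)" for k
    by simp
  then show ?thesis by (simp only: delta_m_def div_x_def) (simp add: partial_mult assms)
qed

lemma delta_u_axis:
  assumes "\<phi> differentiable (at z)"
  shows "delta_u u (\<lambda>y. \<phi> y *\<^sub>R axis i 1) z
    = (partial_t \<phi> z + (\<Sum>k\<in>UNIV. u z $ k * partial_x k \<phi> z)) *\<^sub>R axis i 1 - \<phi> z *\<^sub>R partial_x i u z"
proof -
  have "transpose (Grad_x u z) *v (\<phi> z *\<^sub>R axis i 1) = \<phi> z *\<^sub>R partial_x i u z"
    unfolding vec_eq_iff transpose_Grad_x_mult_nth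
    by (simp add: axis_def if_distrib mult.commute cong: if_cong)
  then show ?thesis
    by (simp add: delta_u_def material_def partial_scaleR_const[OF assms] scaleR_add_left scaleR_sum_left)
qed

lemma delta_b_axis: "delta_b b (\<lambda>y. \<phi> y *\<^sub>R axis i 1) z = - \<phi> z * partial_x i b z"
  by (simp add: delta_b_def inner_axis' grad_x_nth)

text \<open>\<open>P\<close> collects everything that multiplies \<open>delta_u\<close>: the
  velocity slot and, through \<open>delta_material\<close>, the material slots. The result is sorted
  by \<open>\<phi>\<close>, \<open>partial_t \<phi>\<close> and \<open>partial_x k \<phi>\<close> to
  match \<open>weak_conservation_law\<close>. The conditional term is there because
  \<open>delta_m\<close> differentiates \<open>\<phi>\<close> only in direction
  \<open>i\<close>.\<close>

lemma delta_L_axis: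
  fixes L :: "('d::finite, 'n::finite, 'p::finite, 'm::finite) slots \<Rightarrow> real"
    and m :: "'d spacetime \<Rightarrow> real" and u :: "'d spacetime \<Rightarrow> real^'d"
    and b :: "'n \<Rightarrow> 'd spacetime \<Rightarrow> real" and c :: "'p \<Rightarrow> 'd spacetime \<Rightarrow> real"
    and \<xi> :: "'m \<Rightarrow> 'd spacetime \<Rightarrow> real"
  assumes "m differentiable (at z)" "\<phi> differentiable (at z)"
  defines "a \<equiv> slots_along m u b c \<xi>"
  defines "P \<equiv> \<lambda>z. dL_vel L (a z) + (\<Sum>j\<in>UNIV. dL_mat j L (a z) *\<^sub>R grad_x (\<xi> j) z)"
  shows "delta_L L m u b c \<xi> (\<lambda>y. \<phi> y *\<^sub>R axis i 1) (\<lambda>y. 0) (\<lambda>j y. 0) z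
    = (- dL_mass L (a z) * partial_x i m z - P z \<bullet> partial_x i u z
        - (\<Sum>l\<in>UNIV. dL_own l L (a z) * partial_x i (b l) z)) * \<phi> z
      + P z $ i * partial_t \<phi> z
      + (\<Sum>k\<in>UNIV. (P z $ i * u z $ k - (if k = i then dL_mass L (a z) * m z else 0)) * partial_x k \<phi> z)"
proof -
  let ?\<Phi> = "\<lambda>y. \<phi> y *\<^sub>R axis i (1::real)"
  have "delta_L L m u b c \<xi> ?\<Phi> (\<lambda>y. 0) (\<lambda>j y. 0) z
      = dL_mass L (a z) * delta_m m ?\<Phi> z + P z \<bullet> delta_u u ?\<Phi> z
        + (\<Sum>l\<in>UNIV. dL_own l L (a z) * delta_b (b l) ?\<Phi> z)"
    by (simp add: delta_L_def Let_def P_def a_def inner_add_left inner_sum_left)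
  also have "(\<Sum>l\<in>UNIV. dL_own l L (a z) * delta_b (b l) ?\<Phi> z)
      = - (\<Sum>l\<in>UNIV. dL_own l L (a z) * partial_x i (b l) z) * \<phi> z"
    by (simp add: delta_b_axis sum_distrib_left sum_negf mult.commute mult.left_commute)
  also have "P z \<bullet> delta_u u ?\<Phi> z
      = P z $ i * partial_t \<phi> z + (\<Sum>k\<in>UNIV. P z $ i * u z $ k * partial_x k \<phi> z) - P z \<bullet> partial_x i u z * \<phi> z"
    by (simp add: delta_u_axis[OF assms(2)] inner_diff_right inner_axis distrib_left distrib_right
        sum_distrib_left algebra_simps)
  also have "delta_m m ?\<Phi> z = - (partial_x i m z * \<phi> z + m z * partial_x i \<phi> z)"
    by (rule delta_m_axis[OF assms(1,2)])
  also have "(\<Sum>k\<in>UNIV. P z $ i * u z $ k * partial_x k \<phi> z)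
      = (\<Sum>k\<in>UNIV. (P z $ i * u z $ k - (if k = i then dL_mass L (a z) * m z else 0)) * partial_x k \<phi> z)
        + dL_mass L (a z) * m z * partial_x i \<phi> z"
    by (simp add: left_diff_distrib sum_subtractf if_distrib[of "\<lambda>x. x * _"] cong: if_cong)
  finally show ?thesis by (simp add: algebra_simps)
qed

text \<open>With both displacements zero, all slots but those of \<open>\<xi> j\<close>, its
  gradient and its material derivative are stationary. The advecting velocity turns the material
  slot into a flux along \<open>u\<close>, added to the flux \<open>dL_grad j\<close>.\<close>

lemma delta_L_xi:
  fixes L :: "('d::finite, 'n::finite, 'p::finite, 'm::finite) slots \<Rightarrow> real"
    and m :: "'d spacetime \<Rightarrow> real" and u :: "'d spacetime \<Rightarrow> real^'d"
    and b :: "'n \<Rightarrow> 'd spacetime \<Rightarrow> real" and c :: "'p \<Rightarrow> 'd spacetime \<Rightarrow> real"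
    and \<xi> :: "'m \<Rightarrow> 'd spacetime \<Rightarrow> real"
  defines "a \<equiv> slots_along m u b c \<xi>"
  shows "delta_L L m u b c \<xi> (\<lambda>y. 0) (\<lambda>y. 0) (\<lambda>l. if l = j then \<phi> else (\<lambda>y. 0)) z
    = dL_xi j L (a z) * \<phi> z + dL_mat j L (a z) * partial_t \<phi> z
      + (\<Sum>k\<in>UNIV. (dL_mat j L (a z) * u z $ k + dL_grad j L (a z) $ k) * partial_x k \<phi> z)"
proof -
  let ?\<delta> = "\<lambda>l. if l = j then \<phi> else (\<lambda>y. 0)"
  have "(\<Sum>l\<in>UNIV. dL_xi l L (a z) * ?\<delta> l z) = dL_xi j L (a z) * \<phi> z"
    by (subst sum.remove[of _ j]) auto
  moreover have "(\<Sum>l\<in>UNIV. dL_grad l L (a z) \<bullet> grad_x (?\<delta> l) z) = dL_grad j L (a z) \<bullet> grad_x \<phi> z"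
    by (subst sum.remove[of _ j]) auto
  moreover have "(\<Sum>l\<in>UNIV. dL_mat l L (a z) * delta_material u (\<xi> l) (\<lambda>y. 0) (?\<delta> l) z)
      = dL_mat j L (a z) * material u \<phi> z"
    by (subst sum.remove[of _ j]) (auto simp: delta_material_def material_def)
  ultimately show ?thesis
    by (simp add: delta_L_def Let_def a_def inner_vec_def grad_x_nth material_def sum.distrib sum_distrib_left
        algebra_simps)
qed

section \<open>Momentum balance\<close>

text \<open>A spatial derivative also hits the advecting velocity, which leaves the commutator terms
  \<open>partial_x i u z $ k * partial_x k f z\<close>; in the remaining terms the derivatives are
  interchanged.\<close>

lemma partial_x_material:
  fixes f :: "'d::finite spacetime \<Rightarrow> real"
  assumes "open D" "smooth_on D u" "smooth_on D f" "z \<in> D"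
  shows "partial_x i (material u f) z = partial_t (partial_x i f) z
    + (\<Sum>k\<in>UNIV. partial_x i u z $ k * partial_x k f z + u z $ k * partial_x k (partial_x i f) z)"
proof -
  have s: "smooth_on D (partial_t f)" "smooth_on D (partial_x k f)" "smooth_on D (\<lambda>z. u z $ k)"
    "smooth_on D (\<lambda>z. u z $ k * partial_x k f z)" "smooth_on D (\<lambda>z. \<Sum>k\<in>UNIV. u z $ k * partial_x k f z)" for k
    by (intro smooth_on_sum smooth_on_mult smooth_on_vec_nth smooth_on_partial_t smooth_on_partial_x assms; simp)+
  note d = s[THEN smooth_on_differentiable, OF assms(4)] smooth_on_differentiable[OF assms(2,4)]
  show ?thesis
    unfolding material_def[abs_def] real_scaleR_def
    by (simp add: d partial_add partial_sum partial_mult partial_nth partial_x_commute(2)[OF assms(1,3,4)]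
        partial_x_commute(1)[OF assms(1,3,4), of i])
qed

text \<open>\<open>q l\<close> is the derivative of the Lagrangian of the other phase in the slot of \<open>b l\<close>.\<close>

lemma momentum_balance:
  fixes L :: "('d::finite, 'n::finite, 'p::finite, 'm::finite) slots \<Rightarrow> real"
    and D :: "'d spacetime set"
    and m :: "'d spacetime \<Rightarrow> real" and u :: "'d spacetime \<Rightarrow> real^'d"
    and b q :: "'n \<Rightarrow> 'd spacetime \<Rightarrow> real" and c :: "'p \<Rightarrow> 'd spacetime \<Rightarrow> real"
    and \<xi> :: "'m \<Rightarrow> 'd spacetime \<Rightarrow> real"
  assumes D: "open D" and m: "smooth_on D m" and u: "smooth_on D u" and b: "\<And>i. smooth_on D (b i)"
    and c: "\<And>i. smooth_on D (c i)" and \<xi>: "\<And>j. smooth_on D (\<xi> j)"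
    and U: "open U" and L: "smooth_on U L" and aU: "\<And>z. z \<in> D \<Longrightarrow> a z \<in> U"
    and q: "\<And>i. smooth_on D (q i)"
    and a_def: "a = slots_along m u b c \<xi>"
    and K_def: "K = (\<lambda>z. dL_vel L (a z))"
    and M_def: "M = (\<lambda>j z. dL_mat j L (a z))"
    and G_def: "G = (\<lambda>j z. dL_grad j L (a z))"
    and \<Pi>k_def: "\<Pi>k = (\<lambda>z. (L (a z) - m z * dL_mass L (a z)) *\<^sub>R mat 1 - (\<Sum>j\<in>UNIV. grad_x (\<xi> j) z \<otimes> G j z))"
    and weak: "\<And>\<Phi>. test_field D \<Phi> \<Longrightarrow>
      (LINT z:D|lborel. delta_L L m u b c \<xi> \<Phi> (\<lambda>y. 0) (\<lambda>j y. 0) z + (\<Sum>l\<in>UNIV. q l z * delta_b (b l) \<Phi> z)) = 0"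
    and z: "z \<in> D"
  shows "partial_t K z + Div_x (\<lambda>y. K y \<otimes> u y + \<Pi>k y) z =
      - (\<Sum>j\<in>UNIV. (partial_t (M j) z + div_x (\<lambda>y. M j y *\<^sub>R u y) z + div_x (G j) z
                      - dL_xi j L (a z)) *\<^sub>R grad_x (\<xi> j) z)
      + (\<Sum>l\<in>UNIV. dL_other l L (a z) *\<^sub>R grad_x (c l) z)
      - (\<Sum>l\<in>UNIV. q l z *\<^sub>R grad_x (b l) z)"
proof -
  have a: "smooth_on D a" unfolding a_def by (intro smooth_on_slots_along D m u b c \<xi>)
  have along: "smooth_on D (\<lambda>z. f (a z))" if "smooth_on U f"
    for f :: "_ \<Rightarrow> real"
    by (rule smooth_on_compose[OF D U aU that a])
  have along': "smooth_on D (\<lambda>z. f (a z))" if "smooth_on U f"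
    for f :: "_ \<Rightarrow> real^'d"
    by (rule smooth_on_compose[OF D U aU that a])
  define Lm where "Lm = (\<lambda>z. dL_mass L (a z))"
  define P where "P z = K z + (\<Sum>j\<in>UNIV. M j z *\<^sub>R grad_x (\<xi> j) z)" for z
  define g where "g j i = partial_x i (\<xi> j)" for j i
  note dL = smooth_on_dL[OF U L]
  have sL: "smooth_on D (\<lambda>z. L (a z))" by (rule along[OF L])
  have sLm: "smooth_on D Lm" unfolding Lm_def by (rule along[OF dL(1)])
  have K: "smooth_on D K" unfolding K_def by (rule along'[OF dL(2)])
  have M: "smooth_on D (M j)" for j unfolding M_def by (rule along[OF dL(7)])
  have G: "smooth_on D (G j)" for j unfolding G_def by (rule along'[OF dL(6)])
  have g: "smooth_on D (g j i)" for j i unfolding g_def by (rule smooth_on_partial_x[OF D \<xi>])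
  have P: "smooth_on D P" unfolding P_def
    by (intro smooth_on_add smooth_on_sum smooth_on_scaleR smooth_on_grad_x D K M \<xi>) simp
  note nth = smooth_on_vec_nth[OF D]
  note closure = smooth_on_mult[OF D] smooth_on_add[OF D] smooth_on_diff[OF D]
  have P_nth: "P y $ i = K y $ i + (\<Sum>j\<in>UNIV. M j y * g j i y)" for y i
    by (simp add: P_def g_def grad_x_nth)
  note at = smooth_on_differentiable[OF _ z]
  show ?thesis
  proof (rule vec_eq_iff[THEN iffD2], rule allI)
    fix i
    let ?A = "\<lambda>z. - Lm z * partial_x i m z - P z \<bullet> partial_x i u z
      - (\<Sum>l\<in>UNIV. dL_own l L (a z) * partial_x i (b l) z) - (\<Sum>l\<in>UNIV. q l z * partial_x i (b l) z)"
    let ?C = "\<lambda>k z. P z $ i * u z $ k - (if k = i then Lm z * m z else 0)"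
    have sC: "smooth_on D (?C k)" for k
      by (cases "k = i") (auto intro!: closure nth P u sLm m)
    \<comment> \<open>Component \<open>i\<close> of the momentum law, obtained from the displacement
      \<open>\<phi>\<close> times the \<open>i\<close>-th unit vector. The coupling through
      \<open>q\<close> involves no derivative of \<open>\<phi>\<close>, so it only enlarges the
      source \<open>?A\<close>.\<close>
    have W: "?A z = partial_t (\<lambda>z. P z $ i) z + (\<Sum>k\<in>UNIV. partial_x k (?C k) z)"
    proof (rule weak_conservation_law[OF D _ _ sC _ z])
      show "smooth_on D ?A"
        by (intro smooth_on_diff smooth_on_sum smooth_on_mult smooth_on_minus smooth_on_inner
            smooth_on_partial_x D m u b P sLm q along[OF dL(3)]) auto
      show "smooth_on D (\<lambda>z. P z $ i)" by (rule nth[OF P])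
      fix \<phi> :: "'d spacetime \<Rightarrow> real" assume \<phi>: "test_field D \<phi>"
      have "?A y * \<phi> y + P y $ i * partial_t \<phi> y + (\<Sum>k\<in>UNIV. ?C k y * partial_x k \<phi> y)
          = delta_L L m u b c \<xi> (\<lambda>y. \<phi> y *\<^sub>R axis i 1) (\<lambda>y. 0) (\<lambda>j y. 0) y
            + (\<Sum>l\<in>UNIV. q l y * delta_b (b l) (\<lambda>y. \<phi> y *\<^sub>R axis i 1) y)" if y: "y \<in> D" for y
        unfolding delta_L_axis[OF smooth_on_differentiable[OF m y]
            smooth_on_differentiable[OF test_field_smooth_on[OF \<phi>] y]] delta_b_axis Lm_def a_def
        by (simp add: P_def K_def M_def a_def sum_negf sum_distrib_left algebra_simps)
      then have "(LINT y:D|lborel. ?A y * \<phi> y + P y $ i * partial_t \<phi> y + (\<Sum>k\<in>UNIV. ?C k y * partial_x k \<phi> y))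
          = (LINT y:D|lborel. delta_L L m u b c \<xi> (\<lambda>y. \<phi> y *\<^sub>R axis i 1) (\<lambda>y. 0) (\<lambda>j y. 0) y
            + (\<Sum>l\<in>UNIV. q l y * delta_b (b l) (\<lambda>y. \<phi> y *\<^sub>R axis i 1) y))"
        using D by (intro set_lebesgue_integral_cong) auto
      also have "\<dots> = 0" by (rule weak[OF test_field_scaleR_const[OF D \<phi>]])
      finally show "(LINT y:D|lborel. ?A y * \<phi> y + P y $ i * partial_t \<phi> y
        + (\<Sum>k\<in>UNIV. ?C k y * partial_x k \<phi> y)) = 0" .
    qed
    \<comment> \<open>\<open>?S2\<close>, \<open>?S5\<close> and \<open>?S6\<close> occur both in the balance of \<open>P\<close> and in the gradient of \<open>L\<close>
      (through \<open>D\<^sub>t \<xi> j\<close>), and cancel.\<close>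
    let ?S1 = "\<Sum>j\<in>UNIV. partial_t (M j) z * g j i z"
    let ?S2 = "\<Sum>j\<in>UNIV. M j z * partial_t (g j i) z"
    let ?S3 = "\<Sum>k\<in>UNIV. partial_x k (\<lambda>y. K y $ i * u y $ k) z"
    let ?S4 = "\<Sum>j\<in>UNIV. \<Sum>k\<in>UNIV. partial_x k (\<lambda>y. M j y * u y $ k) z * g j i z"
    let ?S5 = "\<Sum>j\<in>UNIV. \<Sum>k\<in>UNIV. M j z * u z $ k * partial_x k (g j i) z"
    let ?S6 = "\<Sum>j\<in>UNIV. \<Sum>k\<in>UNIV. M j z * partial_x i u z $ k * g j k z"
    let ?S7 = "\<Sum>k\<in>UNIV. K z $ k * partial_x i u z $ k"
    let ?S8 = "\<Sum>l\<in>UNIV. dL_own l L (a z) * partial_x i (b l) z"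
    let ?S9 = "\<Sum>l\<in>UNIV. dL_other l L (a z) * partial_x i (c l) z"
    let ?S10 = "\<Sum>j\<in>UNIV. dL_xi j L (a z) * g j i z"
    let ?S11 = "\<Sum>j\<in>UNIV. \<Sum>k\<in>UNIV. G j z $ k * partial_x k (g j i) z"
    let ?S12 = "\<Sum>j\<in>UNIV. \<Sum>k\<in>UNIV. g j i z * partial_x k (\<lambda>y. G j y $ k) z"
    let ?Sq = "\<Sum>l\<in>UNIV. q l z * partial_x i (b l) z"
    have Mg: "smooth_on D (\<lambda>y. M j y * g j i y)" for j i by (intro closure M g)
    have Mgs: "smooth_on D (\<lambda>y. \<Sum>j\<in>UNIV. M j y * g j i y)" for i
      by (intro smooth_on_sum Mg D) simp
    have F1: "partial_t (\<lambda>z. P z $ i) z = partial_t (\<lambda>z. K z $ i) z + ?S1 + ?S2"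
      unfolding P_nth
      by (simp add: partial_add partial_sum partial_mult at M g nth[OF K] Mg Mgs sum.distrib)
    have F2: "(\<Sum>k\<in>UNIV. partial_x k (\<lambda>z. P z $ i * u z $ k) z) = ?S3 + ?S4 + ?S5"
    proof -
      have "partial_x k (\<lambda>z. P z $ i * u z $ k) z
          = partial_x k (\<lambda>y. K y $ i * u y $ k) z
            + ((\<Sum>j\<in>UNIV. partial_x k (\<lambda>y. M j y * u y $ k) z * g j i z)
            + (\<Sum>j\<in>UNIV. M j z * u z $ k * partial_x k (g j i) z))" for k
      proof -
        have eq: "P y $ i * u y $ k = K y $ i * u y $ k + (\<Sum>j\<in>UNIV. (M j y * u y $ k) * g j i y)" for y
          by (simp add: P_nth sum_distrib_left algebra_simps)
        have s: "smooth_on D (\<lambda>y. M j y * u y $ k)" "smooth_on D (\<lambda>y. M j y * u y $ k * g j i y)"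
          "smooth_on D (\<lambda>y. \<Sum>j\<in>UNIV. M j y * u y $ k * g j i y)" "smooth_on D (\<lambda>y. K y $ i * u y $ k)" for j
          by (intro smooth_on_sum closure nth M u g K D; simp)+
        show ?thesis
          unfolding eq by (subst partial_add(2)[OF at[OF s(4)] at[OF s(3)]], subst partial_sum(2)[OF at[OF s(2)]],
              subst partial_mult(2)[OF at[OF s(1)] at[OF g]]) (simp add: sum.distrib)
      qed
      then show ?thesis
        using sum.swap[of "\<lambda>j k. partial_x k (\<lambda>y. M j y * u y $ k) z * g j i z" UNIV UNIV]
          sum.swap[of "\<lambda>j k. M j z * u z $ k * partial_x k (g j i) z" UNIV UNIV]
        by (simp add: sum.distrib)
    qed
    have C_sum: "(\<Sum>k\<in>UNIV. partial_x k (?C k) z)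
        = (\<Sum>k\<in>UNIV. partial_x k (\<lambda>z. P z $ i * u z $ k) z) - partial_x i (\<lambda>z. Lm z * m z) z"
    proof -
      have "partial_x k (?C k) z = partial_x k (\<lambda>z. P z $ i * u z $ k) z
          - (if k = i then partial_x i (\<lambda>z. Lm z * m z) z else 0)" for k
        by (cases "k = i") (auto intro!: partial_diff at closure nth P u sLm m)
      then show ?thesis by (simp add: sum_subtractf)
    qed
    \<comment> \<open>\<open>?S6\<close> is the commutator part; by \<open>F4\<close> the same sum
      occurs in the inner product of \<open>P\<close> with \<open>partial_x i u\<close>.\<close>
    have F3: "(\<Sum>j\<in>UNIV. M j z * partial_x i (material u (\<xi> j)) z) = ?S2 + ?S6 + ?S5"
      by (simp add: partial_x_material[OF D u \<xi> z] g_def distrib_left sum.distrib sum_distrib_left mult.assoc)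
    have F4: "P z \<bullet> partial_x i u z = ?S7 + ?S6"
    proof -
      have "P z \<bullet> partial_x i u z = ?S7 + (\<Sum>k\<in>UNIV. \<Sum>j\<in>UNIV. M j z * partial_x i u z $ k * g j k z)"
        by (simp add: inner_vec_def P_nth sum.distrib sum_distrib_left algebra_simps)
      then show ?thesis by (simp only: sum.swap[of _ UNIV "UNIV :: 'd set"])
    qed
    have F5: "partial_x i (\<lambda>y. L (a y)) z
        = Lm z * partial_x i m z + ?S7 + ?S8 + ?S9 + ?S10 + ?S11 + (?S2 + ?S6 + ?S5)"
    proof -
      have "L differentiable (at (slots_along m u b c \<xi> z))"
        using smooth_on_differentiable[OF L aU[OF z]] by (simp add: a_def)
      moreover have "partial_x i (partial_x k (\<xi> j)) z = partial_x k (g j i) z" for j k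
        unfolding g_def by (rule partial_x_commute(1)[OF D \<xi> z])
      ultimately show ?thesis
        using partial_x_lagrangian[where b = b and c = c and \<xi> = \<xi> and L = L and i = i, OF D m u b c \<xi> z] F3
        by (simp add: a_def[symmetric] Lm_def K_def M_def G_def g_def)
    qed
    have F6: "Div_x (\<lambda>y. K y \<otimes> u y + \<Pi>k y) z $ i
        = ?S3 + partial_x i (\<lambda>y. L (a y)) z - partial_x i (\<lambda>z. Lm z * m z) z - (?S11 + ?S12)"
    proof -
      have "partial_x k (\<lambda>y. (K y \<otimes> u y + \<Pi>k y) $ i $ k) z
          = partial_x k (\<lambda>y. K y $ i * u y $ k) z
            + (if k = i then partial_x i (\<lambda>y. L (a y)) z - partial_x i (\<lambda>z. Lm z * m z) z else 0)
            - (\<Sum>j\<in>UNIV. G j z $ k * partial_x k (g j i) z)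
            - (\<Sum>j\<in>UNIV. g j i z * partial_x k (\<lambda>y. G j y $ k) z)" for k
      proof -
        let ?h = "\<lambda>y. if k = i then L (a y) - Lm y * m y else 0"
        have eq: "(K y \<otimes> u y + \<Pi>k y) $ i $ k = K y $ i * u y $ k + ?h y - (\<Sum>j\<in>UNIV. g j i y * G j y $ k)" for y
          by (simp add: outer_def \<Pi>k_def mat_def Lm_def g_def grad_x_nth mult.commute)
        have s: "smooth_on D (\<lambda>y. K y $ i * u y $ k)" "smooth_on D (\<lambda>y. Lm y * m y)"
          "smooth_on D (\<lambda>y. g j i y * G j y $ k)" "smooth_on D (\<lambda>y. \<Sum>j\<in>UNIV. g j i y * G j y $ k)"
          "smooth_on D (\<lambda>y. G j y $ k)" for j
          by (intro smooth_on_sum closure nth G u g K D sLm m; simp)+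
        have h: "smooth_on D ?h" "partial_x k ?h z
            = (if k = i then partial_x i (\<lambda>y. L (a y)) z - partial_x i (\<lambda>z. Lm z * m z) z else 0)"
          by (cases "k = i"; simp add: closure sL s partial_diff at)+
        have s': "smooth_on D (\<lambda>y. K y $ i * u y $ k + ?h y)" by (rule closure(2)[OF s(1) h(1)])
        show ?thesis
          unfolding eq partial_diff(2)[OF at[OF s'] at[OF s(4)]] partial_add(2)[OF at[OF s(1)] at[OF h(1)]] h(2)
            partial_sum(2)[OF at[OF s(3)]] partial_mult(2)[OF at[OF g] at[OF s(5)]]
          by (simp add: sum.distrib mult.commute)
      qed
      then show ?thesis
        using sum.swap[of "\<lambda>j k. G j z $ k * partial_x k (g j i) z" UNIV UNIV]
          sum.swap[of "\<lambda>j k. g j i z * partial_x k (\<lambda>y. G j y $ k) z" UNIV UNIV]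
        by (simp add: Div_x_def div_x_def sum.distrib sum_subtractf)
    qed
    have F7: "(\<Sum>j\<in>UNIV. (partial_t (M j) z + div_x (\<lambda>y. M j y *\<^sub>R u y) z + div_x (G j) z
          - dL_xi j L (a z)) *\<^sub>R grad_x (\<xi> j) z) $ i = ?S1 + ?S4 + ?S12 - ?S10"
      by (simp add: div_x_def grad_x_nth g_def sum.distrib sum_subtractf sum_distrib_left sum_distrib_right
          algebra_simps)
    have "partial_t K z $ i = partial_t (\<lambda>z. K z $ i) z"
      by (rule partial_nth(1)[symmetric, OF at[OF K]])
    \<comment> \<open>What remains is linear. Eliminating \<open>partial_t K\<close> by
      \<open>W\<close> and inserting \<open>F5\<close> into \<open>F6\<close>, the term
      \<open>Lm z * partial_x i m z\<close> and the sums \<open>?S7\<close> and \<open>?S8\<close>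
      cancel between the weak law and the gradient of \<open>L\<close>, and \<open>?S11\<close>
      cancels between that gradient and the divergence of the tensor. The sums \<open>?S1\<close>,
      \<open>?S4\<close>, \<open>?S12\<close> and \<open>?S10\<close> form the bracket of
      \<open>F7\<close>, leaving \<open>?S9 - ?Sq\<close> as coupling.\<close>
    then show "(partial_t K z + Div_x (\<lambda>y. K y \<otimes> u y + \<Pi>k y) z) $ i =
      (- (\<Sum>j\<in>UNIV. (partial_t (M j) z + div_x (\<lambda>y. M j y *\<^sub>R u y) z + div_x (G j) z
                      - dL_xi j L (a z)) *\<^sub>R grad_x (\<xi> j) z)
      + (\<Sum>l\<in>UNIV. dL_other l L (a z) *\<^sub>R grad_x (c l) z)
      - (\<Sum>l\<in>UNIV. q l z *\<^sub>R grad_x (b l) z)) $ i"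
      using W F1 F2 C_sum F4 F5 F6 F7 by (simp add: grad_x_nth)
  qed
qed

section \<open>The evolution equations of the two phases and of the shared fields\<close>

theorem theorem2p1:
  fixes t0 t1 :: real
    and \<Omega> :: "real \<Rightarrow> (real^'d) set"
    and D :: "'d::finite spacetime set"
    and m1 m2 :: "'d spacetime \<Rightarrow> real"
    and u1 u2 :: "'d spacetime \<Rightarrow> real^'d"
    and b1 :: "'n1::finite \<Rightarrow> 'd spacetime \<Rightarrow> real"
    and b2 :: "'n2::finite \<Rightarrow> 'd spacetime \<Rightarrow> real"
    and \<xi> :: "'m::finite \<Rightarrow> 'd spacetime \<Rightarrow> real"
    and L1 :: "('d, 'n1, 'n2, 'm) slots \<Rightarrow> real"
    and L2 :: "('d, 'n2, 'n1, 'm) slots \<Rightarrow> real"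
    and U1 :: "('d, 'n1, 'n2, 'm) slots set"
    and U2 :: "('d, 'n2, 'n1, 'm) slots set"
    and a1 :: "'d spacetime \<Rightarrow> ('d, 'n1, 'n2, 'm) slots"
    and a2 :: "'d spacetime \<Rightarrow> ('d, 'n2, 'n1, 'm) slots"
    and K1 K2 :: "'d spacetime \<Rightarrow> real^'d"
    and M1 M2 :: "'m \<Rightarrow> 'd spacetime \<Rightarrow> real"
    and D1 D2 :: "'m \<Rightarrow> 'd spacetime \<Rightarrow> real^'d"
    and \<Pi>1 \<Pi>2 :: "'d spacetime \<Rightarrow> real^'d^'d"
  assumes D_def: "D = {(t, x). t \<in> {t0<..<t1} \<and> x \<in> \<Omega> t}"
    and "open D"
    and smooth_m: "smooth_on D m1" "smooth_on D m2"
    and smooth_u: "smooth_on D u1" "smooth_on D u2"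
    and smooth_b: "\<forall>i. smooth_on D (b1 i)" "\<forall>i. smooth_on D (b2 i)"
    and smooth_\<xi>: "\<forall>j. smooth_on D (\<xi> j)"
    and mass: "\<forall>z\<in>D. partial_t m1 z + div_x (\<lambda>y. m1 y *\<^sub>R u1 y) z = 0"
              "\<forall>z\<in>D. partial_t m2 z + div_x (\<lambda>y. m2 y *\<^sub>R u2 y) z = 0"
    and advected: "\<forall>i. \<forall>z\<in>D. material u1 (b1 i) z = 0"
                  "\<forall>i. \<forall>z\<in>D. material u2 (b2 i) z = 0"
    and a1_def: "a1 = slots_along m1 u1 b1 b2 \<xi>"
    and a2_def: "a2 = slots_along m2 u2 b2 b1 \<xi>"
    and "open U1" and "open U2"
    and smooth_L: "smooth_on U1 L1" "smooth_on U2 L2"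
    and admissible: "\<forall>z\<in>D. a1 z \<in> U1" "\<forall>z\<in>D. a2 z \<in> U2"
    and stationary:
      "\<forall>\<Phi>1 \<Phi>2 \<delta>\<xi>. test_field D \<Phi>1 \<and> test_field D \<Phi>2 \<and> (\<forall>j. test_field D (\<delta>\<xi> j)) \<longrightarrow>
         first_variation D L1 L2 m1 m2 u1 u2 b1 b2 \<xi> \<Phi>1 \<Phi>2 \<delta>\<xi> = 0"
    and K1_def: "K1 = (\<lambda>z. dL_vel L1 (a1 z))"
    and K2_def: "K2 = (\<lambda>z. dL_vel L2 (a2 z))"
    and M1_def: "M1 = (\<lambda>j z. dL_mat j L1 (a1 z))"
    and M2_def: "M2 = (\<lambda>j z. dL_mat j L2 (a2 z))"
    and D1_def: "D1 = (\<lambda>j z. dL_grad j L1 (a1 z))"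
    and D2_def: "D2 = (\<lambda>j z. dL_grad j L2 (a2 z))"
    and \<Pi>1_def: "\<Pi>1 = (\<lambda>z. (L1 (a1 z) - m1 z * dL_mass L1 (a1 z)) *\<^sub>R mat 1
                      - (\<Sum>j\<in>UNIV. grad_x (\<xi> j) z \<otimes> D1 j z))"
    and \<Pi>2_def: "\<Pi>2 = (\<lambda>z. (L2 (a2 z) - m2 z * dL_mass L2 (a2 z)) *\<^sub>R mat 1
                      - (\<Sum>j\<in>UNIV. grad_x (\<xi> j) z \<otimes> D2 j z))"
  shows
    "(\<forall>z\<in>D. partial_t K1 z + Div_x (\<lambda>y. K1 y \<otimes> u1 y + \<Pi>1 y) z =
       - (\<Sum>j\<in>UNIV. (partial_t (M1 j) z + div_x (\<lambda>y. M1 j y *\<^sub>R u1 y) z + div_x (D1 j) z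
                        - dL_xi j L1 (a1 z)) *\<^sub>R grad_x (\<xi> j) z)
       + (\<Sum>i\<in>UNIV. dL_other i L1 (a1 z) *\<^sub>R grad_x (b2 i) z)
       - (\<Sum>i\<in>UNIV. dL_other i L2 (a2 z) *\<^sub>R grad_x (b1 i) z)) \<and>
     (\<forall>z\<in>D. partial_t K2 z + Div_x (\<lambda>y. K2 y \<otimes> u2 y + \<Pi>2 y) z =
       - (\<Sum>j\<in>UNIV. (partial_t (M2 j) z + div_x (\<lambda>y. M2 j y *\<^sub>R u2 y) z + div_x (D2 j) z
                        - dL_xi j L2 (a2 z)) *\<^sub>R grad_x (\<xi> j) z)
       - (\<Sum>i\<in>UNIV. dL_other i L1 (a1 z) *\<^sub>R grad_x (b2 i) z)
       + (\<Sum>i\<in>UNIV. dL_other i L2 (a2 z) *\<^sub>R grad_x (b1 i) z)) \<and>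
     (\<forall>j. \<forall>z\<in>D. partial_t (\<lambda>y. M1 j y + M2 j y) z
       + div_x (\<lambda>y. M1 j y *\<^sub>R u1 y + M2 j y *\<^sub>R u2 y + D1 j y + D2 j y) z
       - dL_xi j L1 (a1 z) - dL_xi j L2 (a2 z) = 0)"
proof -
  note D = \<open>open D\<close>
  note s\<xi> = smooth_\<xi>[rule_format] and sb1 = smooth_b(1)[rule_format] and sb2 = smooth_b(2)[rule_format]
  have sa1: "smooth_on D a1" and sa2: "smooth_on D a2"
    unfolding a1_def a2_def by (intro smooth_on_slots_along D smooth_m smooth_u sb1 sb2 s\<xi>)+
  note along1 = smooth_on_compose[OF D \<open>open U1\<close> admissible(1)[rule_format] _ sa1]
    and along2 = smooth_on_compose[OF D \<open>open U2\<close> admissible(2)[rule_format] _ sa2]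
  note dL1 = smooth_on_dL[OF \<open>open U1\<close> smooth_L(1)] and dL2 = smooth_on_dL[OF \<open>open U2\<close> smooth_L(2)]
  note first_variation_zero = stationary[rule_format, unfolded first_variation_def]
  \<comment> \<open>Only phase 1 is displaced. The second Lagrangian then varies through its slots
    for \<open>b1\<close> alone, so \<open>dL_other l L2\<close> along \<open>a2\<close> takes the
    role of \<open>q l\<close>.\<close>
  have mom1: "partial_t K1 z + Div_x (\<lambda>y. K1 y \<otimes> u1 y + \<Pi>1 y) z =
       - (\<Sum>j\<in>UNIV. (partial_t (M1 j) z + div_x (\<lambda>y. M1 j y *\<^sub>R u1 y) z + div_x (D1 j) z
                        - dL_xi j L1 (a1 z)) *\<^sub>R grad_x (\<xi> j) z)
       + (\<Sum>i\<in>UNIV. dL_other i L1 (a1 z) *\<^sub>R grad_x (b2 i) z)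
       - (\<Sum>i\<in>UNIV. dL_other i L2 (a2 z) *\<^sub>R grad_x (b1 i) z)" if z: "z \<in> D" for z
  proof (rule momentum_balance[where b = b1 and c = b2 and \<xi> = \<xi>, OF D smooth_m(1) smooth_u(1) sb1 sb2 s\<xi> \<open>open U1\<close> smooth_L(1)
        admissible(1)[rule_format] along2[OF _ dL2(4)] a1_def K1_def M1_def D1_def \<Pi>1_def _ z])
    fix \<Phi> :: "'d spacetime \<Rightarrow> real^'d" assume "test_field D \<Phi>"
    then show "(LINT z:D|lborel. delta_L L1 m1 u1 b1 b2 \<xi> \<Phi> (\<lambda>y. 0) (\<lambda>j y. 0) z
        + (\<Sum>l\<in>UNIV. dL_other l L2 (a2 z) * delta_b (b1 l) \<Phi> z)) = 0"
      using first_variation_zero[of \<Phi> "\<lambda>y. 0" "\<lambda>j y. 0"]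
      by (simp add: delta_L_other_displacement a2_def)
  qed
  have mom2: "partial_t K2 z + Div_x (\<lambda>y. K2 y \<otimes> u2 y + \<Pi>2 y) z =
       - (\<Sum>j\<in>UNIV. (partial_t (M2 j) z + div_x (\<lambda>y. M2 j y *\<^sub>R u2 y) z + div_x (D2 j) z
                        - dL_xi j L2 (a2 z)) *\<^sub>R grad_x (\<xi> j) z)
       - (\<Sum>i\<in>UNIV. dL_other i L1 (a1 z) *\<^sub>R grad_x (b2 i) z)
       + (\<Sum>i\<in>UNIV. dL_other i L2 (a2 z) *\<^sub>R grad_x (b1 i) z)" if z: "z \<in> D" for z
  proof -
    have "(LINT z:D|lborel. delta_L L2 m2 u2 b2 b1 \<xi> \<Phi> (\<lambda>y. 0) (\<lambda>j y. 0) z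
        + (\<Sum>l\<in>UNIV. dL_other l L1 (a1 z) * delta_b (b2 l) \<Phi> z)) = 0" if "test_field D \<Phi>" for \<Phi>
      using first_variation_zero[of "\<lambda>y. 0" \<Phi> "\<lambda>j y. 0"] that
      by (simp add: delta_L_other_displacement a1_def add.commute)
    from momentum_balance[where b = b2 and c = b1 and \<xi> = \<xi>, OF D smooth_m(2) smooth_u(2) sb2 sb1 s\<xi> \<open>open U2\<close> smooth_L(2)
        admissible(2)[rule_format] along1[OF _ dL1(4)] a2_def K2_def M2_def D2_def \<Pi>2_def this z]
    show ?thesis by (simp add: algebra_simps)
  qed
  \<comment> \<open>Both Lagrangians share the field \<open>\<xi> j\<close>, so one test function
    moves both at once. Stationarity controls only the sum of their contributions, and the weak law
    is applied to that sum.\<close>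
  have \<xi>_eq: "partial_t (\<lambda>y. M1 j y + M2 j y) z
       + div_x (\<lambda>y. M1 j y *\<^sub>R u1 y + M2 j y *\<^sub>R u2 y + D1 j y + D2 j y) z
       - dL_xi j L1 (a1 z) - dL_xi j L2 (a2 z) = 0" if z: "z \<in> D" for j z
  proof -
    let ?A = "\<lambda>z. dL_xi j L1 (a1 z) + dL_xi j L2 (a2 z)" and ?B = "\<lambda>z. M1 j z + M2 j z"
      and ?C = "\<lambda>k z. (M1 j z *\<^sub>R u1 z + M2 j z *\<^sub>R u2 z + D1 j z + D2 j z) $ k"
    have "?A z = partial_t ?B z + (\<Sum>k\<in>UNIV. partial_x k (?C k) z)"
    proof (rule weak_conservation_law[OF D _ _ _ _ z])
      show "smooth_on D ?A"
        by (rule smooth_on_add[OF D along1[OF _ dL1(5)] along2[OF _ dL2(5)]])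
      have M: "smooth_on D (M1 j)" "smooth_on D (M2 j)"
        unfolding M1_def M2_def by (rule along1[OF _ dL1(7)] along2[OF _ dL2(7)]; assumption)+
      have G: "smooth_on D (D1 j)" "smooth_on D (D2 j)"
        unfolding D1_def D2_def by (rule along1[OF _ dL1(6)] along2[OF _ dL2(6)]; assumption)+
      show "smooth_on D ?B" by (rule smooth_on_add[OF D M])
      show "smooth_on D (?C k)" for k
        by (intro smooth_on_vec_nth smooth_on_add smooth_on_scaleR D M G smooth_u)
      fix \<phi> :: "'d spacetime \<Rightarrow> real" assume \<phi>: "test_field D \<phi>"
      let ?\<delta> = "\<lambda>l. if l = j then \<phi> else (\<lambda>y. 0)"
      have "?A y * \<phi> y + ?B y * partial_t \<phi> y + (\<Sum>k\<in>UNIV. ?C k y * partial_x k \<phi> y)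
          = delta_L L1 m1 u1 b1 b2 \<xi> (\<lambda>y. 0) (\<lambda>y. 0) ?\<delta> y + delta_L L2 m2 u2 b2 b1 \<xi> (\<lambda>y. 0) (\<lambda>y. 0) ?\<delta> y" for y
        unfolding delta_L_xi a1_def[symmetric] a2_def[symmetric]
        by (simp add: M1_def M2_def D1_def D2_def distrib_left distrib_right sum.distrib)
      moreover have "(LINT y:D|lborel. delta_L L1 m1 u1 b1 b2 \<xi> (\<lambda>y. 0) (\<lambda>y. 0) ?\<delta> y
          + delta_L L2 m2 u2 b2 b1 \<xi> (\<lambda>y. 0) (\<lambda>y. 0) ?\<delta> y) = 0"
        using \<phi> by (intro first_variation_zero) auto
      ultimately show "(LINT y:D|lborel. ?A y * \<phi> y + ?B y * partial_t \<phi> y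
          + (\<Sum>k\<in>UNIV. ?C k y * partial_x k \<phi> y)) = 0"
        by simp
    qed
    then show ?thesis by (simp add: div_x_def)
  qed
  show ?thesis using mom1 mom2 \<xi>_eq by blast
qed

end
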